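(* It is decidable whether a given regular forest language $L$ is definable by a $\Sigma_1(<,<_{\mathrm{dfs}})$ sentence; i.e. there is an algorithm which, given a regular forest language $L$ over a finite alphabet $A$, decides whether there is a $\Sigma_1(<,<_{\mathrm{dfs}})$ sentence whose set of models (among forests over $A$) is $L$.
   Context: Forests over a finite alphabet $A$ are finite, ordered, unranked, $A$-labelled forests (finite sequences of trees, the empty forest allowed). A forest is viewed as a relational structure whose domain is its set of nodes, with equality, unary predicates $P_a$ ($a\in A$) for labels, the strict ancestor relation $x<y$ ($x$ is a strict ancestor of $y$), and the linear order $<_{\mathrm{dfs}}$ given by depth-first left-first traversal. A $\Sigma_1(<,<_{\mathrm{dfs}})$ sentence has the form $\exists x_1\cdots\exists x_n\,\gamma$ with $\gamma$ quantifier-free over these predicates. Contexts over $A$ are forests over $A\cup\{\Box\}$ with exactly one node, a leaf, labelled $\Box$ (the hole). A forest algebra is a pair $(H,V)$ of monoids, $H$ additive (not necessarily commutative), $V$ multiplicative with identity $\Box$, with a faithful monoidal left action of $V$ on $H$ and elements $g+\Box,\Box+g\in V$ for each $g\in H$ acting by $h\mapsto g+h$, $h\mapsto h+g$. $A^\Delta$ is the free forest algebra of forests (under concatenation) and contexts (under substitution in the hole) over $A$; a morphism $A^\Delta\to(H,V)$ is determined by the images of the contexts $a\Box$, $a\in A$. A regular forest language is one of the form $\alpha^{-1}(X)$ with $\alpha:A^\Delta\to(H,V)$ a morphism to a finite forest algebra and $X\subseteq H$; as input it is given by such $(H,V)$, $\alpha$, $X$ (or any effectively equivalent representation). *)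

theory Defs
  imports "HOL-Algebra.Group" "HOL-Library.Nat_Bijection" "HOL-Library.Sublist"
begin

datatype recf =
    Zero
  | Succ
  | Proj nat
  | Comp recf "recf list"
  | PrimRec recf recf
  | Mu recf

text \<open>\<open>computes p xs y\<close>: the partial recursive function denoted by \<open>p\<close> is defined on the
  argument tuple \<open>xs\<close> and has the value \<open>y\<close> there.\<close>

inductive computes :: "recf \<Rightarrow> nat list \<Rightarrow> nat \<Rightarrow> bool" where
  "computes Zero xs 0"
| "computes Succ [x] (Suc x)"
| "i < length xs \<Longrightarrow> computes (Proj i) xs (xs ! i)"
| "list_all2 (\<lambda>g y. computes g xs y) gs ys \<Longrightarrow> computes f ys z \<Longrightarrow> computes (Comp f gs) xs z"
| "computes f xs y \<Longrightarrow> computes (PrimRec f g) (0 # xs) y"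
| "computes (PrimRec f g) (n # xs) r \<Longrightarrow> computes g (n # r # xs) y \<Longrightarrow>
     computes (PrimRec f g) (Suc n # xs) y"
| "computes f (n # xs) 0 \<Longrightarrow> \<forall>i<n. \<exists>y. computes f (i # xs) (Suc y) \<Longrightarrow>
     computes (Mu f) xs n"

lemma computes_deterministic: "computes p xs y \<Longrightarrow> computes p xs z \<Longrightarrow> y = z"
proof (induction arbitrary: z rule: computes.induct)
  case (4 xs gs ys f w)
  from "4.prems" obtain ys' where
    ys': "list_all2 (\<lambda>g y. computes g xs y) gs ys'" "computes f ys' z"
    by (auto elim: computes.cases)
  have "ys = ys'"
    using "4.IH"(1) ys'(1) by (auto simp: list_all2_conv_all_nth intro!: nth_equalityI)
  with ys'(2) have "computes f ys z" by simp
  then show ?case by (rule "4.IH"(2))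
next
  case (5 f xs y g)
  from "5.prems" have "computes f xs z" by (auto elim: computes.cases)
  then show ?case by (rule "5.IH")
next
  case (6 f g n xs r y)
  from "6.prems" obtain r' where r': "computes (PrimRec f g) (n # xs) r'" "computes g (n # r' # xs) z"
    by (auto elim: computes.cases)
  from "6.IH"(1)[OF r'(1)] r'(2) have "computes g (n # r # xs) z" by simp
  then show ?case by (rule "6.IH"(2))
next
  case (7 f n xs)
  from "7.prems" have z: "computes f (z # xs) 0" "\<forall>i<z. \<exists>y. computes f (i # xs) (Suc y)"
    by (auto elim: computes.cases)
  have "\<not> z < n" using "7.IH"(2) z(1) by fastforce
  moreover have "\<not> n < z" using "7.IH"(1) z(2) by fastforce
  ultimately show ?case by simp
qed (auto elim: computes.cases)

datatype 'a tree = Node (label: 'a) (children: "'a tree list")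

type_synonym 'a forest = "'a tree list"

definition forests :: "'a set \<Rightarrow> 'a forest set" where
  "forests A = lists {t. set_tree t \<subseteq> A}"

text \<open>A node is addressed by the nonempty list of sibling positions on the path that leads to it
  from a root.\<close>

type_synonym node = "nat list"

fun subtree :: "'a forest \<Rightarrow> node \<Rightarrow> 'a tree option" where
  "subtree f [] = None"
| "subtree f [i] = (if i < length f then Some (f ! i) else None)"
| "subtree f (i # p) = (if i < length f then subtree (children (f ! i)) p else None)"

definition nodes :: "'a forest \<Rightarrow> node set" where
  "nodes f = {x. subtree f x \<noteq> None}"

definition label_at :: "'a forest \<Rightarrow> node \<Rightarrow> 'a" where
  "label_at f x = label (the (subtree f x))"

definition leaf_at :: "'a forest \<Rightarrow> node \<Rightarrow> bool" where
  "leaf_at f x \<longleftrightarrow> children (the (subtree f x)) = []"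

text \<open>On addresses, the order of the depth-first left-first traversal is the lexicographic one, in
  which a proper prefix (a strict ancestor) comes first.\<close>

definition dfs_less :: "node \<Rightarrow> node \<Rightarrow> bool" where
  "dfs_less x y \<longleftrightarrow> (x, y) \<in> lexord {(i, j). i < j}"

text \<open>The constant \<open>Tru\<close> matters for sentences with an empty quantifier prefix.\<close>

datatype 'a qf =
    Tru
  | Equal nat nat
  | Label 'a nat
  | Anc nat nat
  | Dfs nat nat
  | Neg "'a qf"
  | And "'a qf" "'a qf"
  | Or "'a qf" "'a qf"

primrec qf_vars :: "'a qf \<Rightarrow> nat set" where
  "qf_vars Tru = {}"
| "qf_vars (Equal i j) = {i, j}"
| "qf_vars (Label a i) = {i}"
| "qf_vars (Anc i j) = {i, j}"
| "qf_vars (Dfs i j) = {i, j}"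
| "qf_vars (Neg \<gamma>) = qf_vars \<gamma>"
| "qf_vars (And \<gamma> \<delta>) = qf_vars \<gamma> \<union> qf_vars \<delta>"
| "qf_vars (Or \<gamma> \<delta>) = qf_vars \<gamma> \<union> qf_vars \<delta>"

primrec holds :: "'a forest \<Rightarrow> (nat \<Rightarrow> node) \<Rightarrow> 'a qf \<Rightarrow> bool" where
  "holds f \<nu> Tru \<longleftrightarrow> True"
| "holds f \<nu> (Equal i j) \<longleftrightarrow> \<nu> i = \<nu> j"
| "holds f \<nu> (Label a i) \<longleftrightarrow> label_at f (\<nu> i) = a"
| "holds f \<nu> (Anc i j) \<longleftrightarrow> strict_prefix (\<nu> i) (\<nu> j)"
| "holds f \<nu> (Dfs i j) \<longleftrightarrow> dfs_less (\<nu> i) (\<nu> j)"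
| "holds f \<nu> (Neg \<gamma>) \<longleftrightarrow> \<not> holds f \<nu> \<gamma>"
| "holds f \<nu> (And \<gamma> \<delta>) \<longleftrightarrow> holds f \<nu> \<gamma> \<and> holds f \<nu> \<delta>"
| "holds f \<nu> (Or \<gamma> \<delta>) \<longleftrightarrow> holds f \<nu> \<gamma> \<or> holds f \<nu> \<delta>"

text \<open>\<open>Exists n \<gamma>\<close> is the sentence with \<open>n\<close> existential quantifiers, binding the variables below
  \<open>n\<close>, in front of \<open>\<gamma>\<close>.\<close>

datatype 'a sigma1 = Exists nat "'a qf"

fun sigma1_sentence :: "'a set \<Rightarrow> 'a sigma1 \<Rightarrow> bool" where
  "sigma1_sentence A (Exists n \<gamma>) \<longleftrightarrow> qf_vars \<gamma> \<subseteq> {..<n} \<and> set_qf \<gamma> \<subseteq> A"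

fun satisfies :: "'a forest \<Rightarrow> 'a sigma1 \<Rightarrow> bool" where
  "satisfies f (Exists n \<gamma>) \<longleftrightarrow> (\<exists>\<nu>. (\<forall>i<n. \<nu> i \<in> nodes f) \<and> holds f \<nu> \<gamma>)"

definition sigma1_definable :: "'a set \<Rightarrow> 'a forest set \<Rightarrow> bool" where
  "sigma1_definable A L \<longleftrightarrow>
     (\<exists>\<phi>. sigma1_sentence A \<phi> \<and> L = {f \<in> forests A. satisfies f \<phi>})"

text \<open>The horizontal monoid is written multiplicatively here and need not be commutative.
  \<open>ins_left F g\<close> and \<open>ins_right F g\<close> stand for the elements \<open>g + \<box>\<close> and \<open>\<box> + g\<close>.\<close>

record ('h, 'v) forest_alg =
  hor :: "'h monoid"
  ver :: "'v monoid"
  act :: "'v \<Rightarrow> 'h \<Rightarrow> 'h"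
  ins_left :: "'h \<Rightarrow> 'v"
  ins_right :: "'h \<Rightarrow> 'v"

locale forest_algebra =
  fixes F :: "('h, 'v) forest_alg"
  assumes hor_monoid: "monoid (hor F)"
    and ver_monoid: "monoid (ver F)"
    and act_closed: "\<lbrakk>v \<in> carrier (ver F); h \<in> carrier (hor F)\<rbrakk> \<Longrightarrow> act F v h \<in> carrier (hor F)"
    and act_one: "h \<in> carrier (hor F) \<Longrightarrow> act F \<one>\<^bsub>ver F\<^esub> h = h"
    and act_mult: "\<lbrakk>v \<in> carrier (ver F); w \<in> carrier (ver F); h \<in> carrier (hor F)\<rbrakk> \<Longrightarrow>
      act F (v \<otimes>\<^bsub>ver F\<^esub> w) h = act F v (act F w h)"
    and act_faithful: "\<lbrakk>v \<in> carrier (ver F); w \<in> carrier (ver F);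
      \<And>h. h \<in> carrier (hor F) \<Longrightarrow> act F v h = act F w h\<rbrakk> \<Longrightarrow> v = w"
    and ins_left_closed: "g \<in> carrier (hor F) \<Longrightarrow> ins_left F g \<in> carrier (ver F)"
    and ins_right_closed: "g \<in> carrier (hor F) \<Longrightarrow> ins_right F g \<in> carrier (ver F)"
    and act_ins_left: "\<lbrakk>g \<in> carrier (hor F); h \<in> carrier (hor F)\<rbrakk> \<Longrightarrow>
      act F (ins_left F g) h = g \<otimes>\<^bsub>hor F\<^esub> h"
    and act_ins_right: "\<lbrakk>g \<in> carrier (hor F); h \<in> carrier (hor F)\<rbrakk> \<Longrightarrow>
      act F (ins_right F g) h = h \<otimes>\<^bsub>hor F\<^esub> g"

definition monoid_morphism :: "'a monoid \<Rightarrow> 'b monoid \<Rightarrow> ('a \<Rightarrow> 'b) \<Rightarrow> bool" where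
  "monoid_morphism M N \<phi> \<longleftrightarrow> \<phi> \<in> hom M N \<and> \<phi> \<one>\<^bsub>M\<^esub> = \<one>\<^bsub>N\<^esub>"

definition forest_alg_morphism ::
  "('h, 'v) forest_alg \<Rightarrow> ('i, 'w) forest_alg \<Rightarrow> ('h \<Rightarrow> 'i) \<Rightarrow> ('v \<Rightarrow> 'w) \<Rightarrow> bool" where
  "forest_alg_morphism F G \<alpha> \<beta> \<longleftrightarrow>
     monoid_morphism (hor F) (hor G) \<alpha> \<and> monoid_morphism (ver F) (ver G) \<beta> \<and>
     (\<forall>v \<in> carrier (ver F). \<forall>h \<in> carrier (hor F). \<alpha> (act F v h) = act G (\<beta> v) (\<alpha> h)) \<and>
     (\<forall>g \<in> carrier (hor F). \<beta> (ins_left F g) = ins_left G (\<alpha> g) \<and>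
                             \<beta> (ins_right F g) = ins_right G (\<alpha> g))"

text \<open>The hole is the label \<open>None\<close>; a letter \<open>a\<close> becomes \<open>Some a\<close>.\<close>

definition contexts :: "'a set \<Rightarrow> 'a option forest set" where
  "contexts A = {c \<in> forests (insert None (Some ` A)).
     (\<exists>!x. x \<in> nodes c \<and> label_at c x = None) \<and>
     (\<forall>x \<in> nodes c. label_at c x = None \<longrightarrow> leaf_at c x)}"

text \<open>\<open>fill r s c\<close> substitutes the forest \<open>s\<close> for the hole of \<open>c\<close> and relabels each proper letter
  \<open>a\<close> of \<open>c\<close> to \<open>r a\<close>: with \<open>r = id\<close> this applies a context to a forest, with \<open>r = Some\<close> it
  composes two contexts.\<close>

primrec fill_tree :: "('a \<Rightarrow> 'b) \<Rightarrow> 'b forest \<Rightarrow> 'a option tree \<Rightarrow> 'b forest" where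
  "fill_tree r s (Node l ts) =
     (case l of None \<Rightarrow> s | Some a \<Rightarrow> [Node (r a) (concat (map (fill_tree r s) ts))])"

definition fill :: "('a \<Rightarrow> 'b) \<Rightarrow> 'b forest \<Rightarrow> 'a option forest \<Rightarrow> 'b forest" where
  "fill r s c = concat (map (fill_tree r s) c)"

abbreviation hole :: "'a option forest" where
  "hole \<equiv> [Node None []]"

definition free_forest_algebra :: "'a set \<Rightarrow> ('a forest, 'a option forest) forest_alg" where
  "free_forest_algebra A =
     \<lparr>hor = \<lparr>carrier = forests A, mult = (@), one = []\<rparr>,
      ver = \<lparr>carrier = contexts A, mult = (\<lambda>c d. fill Some d c), one = hole\<rparr>,
      act = (\<lambda>c f. fill id f c),
      ins_left = (\<lambda>g. map (map_tree Some) g @ hole),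
      ins_right = (\<lambda>g. hole @ map (map_tree Some) g)\<rparr>"

definition letter_context :: "'a \<Rightarrow> 'a option forest" where
  "letter_context a = [Node (Some a) hole]"

definition encode_table :: "(nat \<Rightarrow> nat \<Rightarrow> nat) \<Rightarrow> nat \<Rightarrow> nat \<Rightarrow> nat" where
  "encode_table g m k = list_encode (map (\<lambda>i. list_encode (map (g i) [0..<k])) [0..<m])"

text \<open>\<open>encodes n c L\<close>: the number \<open>c\<close> codes a finite forest algebra \<open>F\<close>, the images of the contexts
  \<open>letter_context a\<close> under a morphism \<open>(\<alpha>, \<beta>)\<close> from the free forest algebra, and a set \<open>X\<close> such
  that \<open>L\<close> is the inverse image of \<open>X\<close>.  Up to renaming, the alphabet and the two carriers of \<open>F\<close>
  are initial segments of the natural numbers, so every regular forest language over a finite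
  alphabet has such codes.\<close>

definition encodes :: "nat \<Rightarrow> nat \<Rightarrow> nat forest set \<Rightarrow> bool" where
  "encodes n c L \<longleftrightarrow>
     (\<exists>(F :: (nat, nat) forest_alg) m k \<alpha> \<beta> X.
        forest_algebra F \<and> carrier (hor F) = {..<m} \<and> carrier (ver F) = {..<k} \<and>
        forest_alg_morphism (free_forest_algebra {..<n}) F \<alpha> \<beta> \<and>
        X \<subseteq> carrier (hor F) \<and>
        L = {f \<in> forests {..<n}. \<alpha> f \<in> X} \<and>
        c = list_encode
          [n, m, k,
           \<one>\<^bsub>hor F\<^esub>, encode_table (mult (hor F)) m m,
           \<one>\<^bsub>ver F\<^esub>, encode_table (mult (ver F)) k k,
           encode_table (act F) k m,
           list_encode (map (ins_left F) [0..<m]), list_encode (map (ins_right F) [0..<m]),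
           list_encode (map (\<lambda>a. \<beta> (letter_context a)) [0..<n]),
           list_encode (sorted_list_of_set X)])"

end

theory Submission
  imports Defs
begin

text \<open>A \<open>\<Sigma>\<^sub>1\<close> sentence is preserved when nodes are inserted into a forest, so a definable language
  is upward closed under the relation \<open>embeds\<close> (deletion of nodes, the children of a deleted node
  taking its place).  Conversely, let \<open>L\<close> be regular and upward closed.  In a minimal element of \<open>L\<close>,
  viewed as a binary tree by first children and next siblings, no two forests on a common path have
  the same value in the forest algebra, since otherwise the larger could be replaced by the
  smaller.  So there are finitely many minimal elements, and the disjunction of their diagrams
  defines \<open>L\<close>.

  Upward closure is decidable: the pairs of values of forests \<open>f\<close>, \<open>g\<close> with \<open>embeds f g\<close> form the least
  relation on the finite horizontal monoid that contains \<open>(0, 0)\<close> and satisfies two closure conditions,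
  and \<open>L\<close> is upward closed iff some relation with these properties never leads from the accepting set to
  its complement.  The relations are coded by numbers below \<open>2 ^ (m * m)\<close>, which makes the test a formula
  with bounded quantifiers.\<close>

section \<open>Recursive functions and decidable predicates\<close>

text \<open>Only lists of length \<open>k\<close> count, so the values of \<open>hd\<close>,
  \<open>tl\<close> and \<open>!\<close> on shorter lists never matter.\<close>

definition recursive :: "nat \<Rightarrow> (nat list \<Rightarrow> nat) \<Rightarrow> bool" where
  "recursive k f \<longleftrightarrow> (\<exists>p. \<forall>xs. length xs = k \<longrightarrow> computes p xs (f xs))"

definition decidable :: "nat \<Rightarrow> (nat list \<Rightarrow> bool) \<Rightarrow> bool" where
  "decidable k P \<longleftrightarrow> recursive k (\<lambda>xs. if P xs then 1 else 0)"

abbreviation recursive1 :: "(nat \<Rightarrow> nat) \<Rightarrow> bool" where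
  "recursive1 f \<equiv> recursive 1 (\<lambda>xs. f (hd xs))"

abbreviation recursive2 :: "(nat \<Rightarrow> nat \<Rightarrow> nat) \<Rightarrow> bool" where
  "recursive2 f \<equiv> recursive 2 (\<lambda>xs. f (hd xs) (hd (tl xs)))"

lemma recursive_nth: "i < k \<Longrightarrow> recursive k (\<lambda>xs. xs ! i)"
  unfolding recursive_def by (intro exI[of _ "Proj i"]) (auto intro: computes.intros)

lemma recursive_cong:
  assumes "recursive k f" "\<And>xs. length xs = k \<Longrightarrow> f xs = g xs"
  shows "recursive k g"
  using assms by (auto simp: recursive_def)

lemma recursive_hd_tls:
  assumes "i < k"
  shows "recursive k (\<lambda>xs. hd ((tl ^^ i) xs))"
proof (rule recursive_cong[OF recursive_nth[OF assms]])
  fix xs :: "nat list"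
  assume "length xs = k"
  moreover have "(tl ^^ i) xs = drop i xs"
    by (induction i) (auto simp: drop_Suc tl_drop)
  ultimately show "xs ! i = hd ((tl ^^ i) xs)"
    using assms by (simp add: hd_drop_conv_nth)
qed

text \<open>The list argument is an environment: recursion, minimization and quantifiers push their bound
  variable to its front, so that the lemmas below give access to the enclosing variables from the
  inside out.\<close>

lemma recursive_vars:
  "0 < k \<Longrightarrow> recursive k (\<lambda>xs. hd xs)"
  "1 < k \<Longrightarrow> recursive k (\<lambda>xs. hd (tl xs))"
  "2 < k \<Longrightarrow> recursive k (\<lambda>xs. hd (tl (tl xs)))"
  "3 < k \<Longrightarrow> recursive k (\<lambda>xs. hd (tl (tl (tl xs))))"
  "4 < k \<Longrightarrow> recursive k (\<lambda>xs. hd (tl (tl (tl (tl xs)))))"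
  "5 < k \<Longrightarrow> recursive k (\<lambda>xs. hd (tl (tl (tl (tl (tl xs))))))"
  "6 < k \<Longrightarrow> recursive k (\<lambda>xs. hd (tl (tl (tl (tl (tl (tl xs)))))))"
  using recursive_hd_tls[of 0 k] recursive_hd_tls[of 1 k] recursive_hd_tls[of 2 k]
    recursive_hd_tls[of 3 k] recursive_hd_tls[of 4 k] recursive_hd_tls[of 5 k]
    recursive_hd_tls[of 6 k]
  by (simp_all add: eval_nat_numeral)

lemma recursive_comp:
  assumes f: "recursive (length gs) f" and gs: "\<And>g. g \<in> set gs \<Longrightarrow> recursive k g"
  shows "recursive k (\<lambda>xs. f (map (\<lambda>g. g xs) gs))"
proof -
  obtain p where p: "\<And>xs. length xs = length gs \<Longrightarrow> computes p xs (f xs)"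
    using f by (auto simp: recursive_def)
  obtain q where q: "\<And>g xs. g \<in> set gs \<Longrightarrow> length xs = k \<Longrightarrow> computes (q g) xs (g xs)"
    using gs unfolding recursive_def by metis
  have "computes (Comp p (map q gs)) xs (f (map (\<lambda>g. g xs) gs))" if "length xs = k" for xs
    by (rule computes.intros(4)[where ys = "map (\<lambda>g. g xs) gs"])
      (use that p q in \<open>auto simp: list_all2_conv_all_nth\<close>)
  then show ?thesis by (auto simp: recursive_def)
qed

lemma recursive_comp1:
  assumes "recursive1 f" "recursive k g"
  shows "recursive k (\<lambda>xs. f (g xs))"
  using recursive_comp[of "[g]" "\<lambda>xs. f (hd xs)" k] assms by simp

lemma recursive_comp2:
  assumes "recursive2 f" "recursive k g" "recursive k h"
  shows "recursive k (\<lambda>xs. f (g xs) (h xs))"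
  using recursive_comp[of "[g, h]" "\<lambda>xs. f (hd xs) (hd (tl xs))" k] assms
  by (auto simp: numeral_2_eq_2)

lemma recursive_Suc: "recursive k g \<Longrightarrow> recursive k (\<lambda>xs. Suc (g xs))"
proof (rule recursive_comp1[of Suc])
  show "recursive1 Suc"
    unfolding recursive_def
    by (intro exI[of _ Succ]) (auto simp: length_Suc_conv intro: computes.intros)
qed

lemma recursive_const: "recursive k (\<lambda>xs. c)"
proof (induction c)
  case 0
  show ?case unfolding recursive_def by (auto intro: computes.intros)
qed (rule recursive_Suc)

lemma recursive_rec_nat:
  assumes b: "recursive k b" and f: "recursive k f"
    and g: "recursive (Suc (Suc k)) (\<lambda>ys. g (hd ys) (hd (tl ys)) (tl (tl ys)))"
  shows "recursive k (\<lambda>xs. rec_nat (f xs) (\<lambda>n r. g n r xs) (b xs))"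
proof -
  obtain p where p: "\<And>xs. length xs = k \<Longrightarrow> computes p xs (f xs)"
    using f by (auto simp: recursive_def)
  obtain q where q: "\<And>ys. length ys = Suc (Suc k) \<Longrightarrow>
      computes q ys (g (hd ys) (hd (tl ys)) (tl (tl ys)))"
    using g by (auto simp: recursive_def)
  have step: "computes (PrimRec p q) (n # xs) (rec_nat (f xs) (\<lambda>n r. g n r xs) n)"
    if "length xs = k" for n xs
  proof (induction n)
    case 0
    show ?case using p[OF that] by (auto intro: computes.intros)
  next
    case (Suc n)
    show ?case
      using computes.intros(6)[OF Suc q[of "n # rec_nat (f xs) (\<lambda>n r. g n r xs) n # xs"]] that
      by simp
  qed
  have "recursive (Suc k) (\<lambda>ys. rec_nat (f (tl ys)) (\<lambda>n r. g n r (tl ys)) (hd ys))"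
    unfolding recursive_def using step
    by (auto simp: length_Suc_conv intro!: exI[of _ "PrimRec p q"])
  \<comment> \<open>\<open>PrimRec\<close> recurses on its first argument; composition with
    \<open>b\<close> and the \<open>k\<close> projections puts \<open>b xs\<close> there and keeps
    the parameters \<open>xs\<close> behind it.\<close>
  then have "recursive k (\<lambda>xs. (\<lambda>ys. rec_nat (f (tl ys)) (\<lambda>n r. g n r (tl ys)) (hd ys))
      (map (\<lambda>g. g xs) (b # map (\<lambda>i xs. xs ! i) [0..<k])))"
    by (intro recursive_comp) (auto simp: b intro: recursive_nth)
  then show ?thesis
  proof (rule recursive_cong)
    fix xs :: "nat list" assume "length xs = k"
    then have "map (\<lambda>g. g xs) (map (\<lambda>i xs. xs ! i) [0..<k]) = xs"
      by (auto simp: comp_def map_nth)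
    then show "(\<lambda>ys. rec_nat (f (tl ys)) (\<lambda>n r. g n r (tl ys)) (hd ys))
      (map (\<lambda>g. g xs) (b # map (\<lambda>i xs. xs ! i) [0..<k])) =
      rec_nat (f xs) (\<lambda>n r. g n r xs) (b xs)" by simp
  qed
qed

lemma recursive_Least:
  assumes "decidable (Suc k) (\<lambda>ys. P (hd ys) (tl ys))" and ex: "\<And>xs. \<exists>n. P n xs"
  shows "recursive k (\<lambda>xs. LEAST n. P n xs)"
proof -
  \<comment> \<open>\<open>Mu\<close> searches for a zero, but truth is coded by 1. The recursion
    over the truth value, with base value 1 and step value 0, swaps the two.\<close>
  have "recursive (Suc k) (\<lambda>ys. rec_nat 1 (\<lambda>n r. 0) (if P (hd ys) (tl ys) then 1 else 0))"
    using assms(1) unfolding decidable_def by (intro recursive_rec_nat recursive_const)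
  then obtain p where p: "\<And>ys. length ys = Suc k \<Longrightarrow>
      computes p ys (rec_nat 1 (\<lambda>n r. 0) (if P (hd ys) (tl ys) then 1 else 0))"
    by (auto simp: recursive_def)
  have "computes (Mu p) xs (LEAST n. P n xs)" if "length xs = k" for xs
  proof (rule computes.intros(7))
    show "computes p ((LEAST n. P n xs) # xs) 0"
      using p[of "(LEAST n. P n xs) # xs"] that LeastI_ex[OF ex, of xs] by simp
    show "\<forall>i<LEAST n. P n xs. \<exists>y. computes p (i # xs) (Suc y)"
    proof (intro allI impI)
      fix i assume "i < (LEAST n. P n xs)"
      then have "\<not> P i xs" by (rule not_less_Least)
      then show "\<exists>y. computes p (i # xs) (Suc y)"
        using p[of "i # xs"] that by auto
    qed
  qed
  then show ?thesis by (auto simp: recursive_def)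
qed

lemma recursive_add:
  assumes "recursive k f" "recursive k g"
  shows "recursive k (\<lambda>xs. f xs + g xs)"
proof (rule recursive_comp2[OF _ assms])
  have "recursive2 (\<lambda>x y. rec_nat y (\<lambda>n r. Suc r) x)"
    by (intro recursive_rec_nat recursive_Suc recursive_vars) auto
  moreover have "rec_nat y (\<lambda>n r. Suc r) x = x + y" for x y
    by (induction x) auto
  ultimately show "recursive2 (+)" by simp
qed

lemma recursive_diff:
  assumes "recursive k f" "recursive k g"
  shows "recursive k (\<lambda>xs. f xs - g xs)"
proof (rule recursive_comp2[OF _ assms])
  \<comment> \<open>The inner recursion is the predecessor function; iterating it gives truncated
    subtraction.\<close>
  have "recursive2 (\<lambda>x y. rec_nat x (\<lambda>_ r. rec_nat 0 (\<lambda>n _. n) r) y)"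
    by (intro recursive_rec_nat recursive_const recursive_vars) auto
  moreover have "rec_nat 0 (\<lambda>n _. n) x = x - 1" for x :: nat
    by (cases x) auto
  moreover have "rec_nat x (\<lambda>_ r. r - 1) y = x - y" for x y :: nat
    by (induction y) auto
  ultimately show "recursive2 (-)" by simp
qed

lemma recursive_mult:
  assumes "recursive k f" "recursive k g"
  shows "recursive k (\<lambda>xs. f xs * g xs)"
proof (rule recursive_comp2[OF _ assms])
  have "recursive2 (\<lambda>x y. rec_nat 0 (\<lambda>_ r. y + r) x)"
    by (intro recursive_rec_nat recursive_const recursive_add recursive_vars) auto
  moreover have "rec_nat 0 (\<lambda>_ r. y + r) x = x * y" for x y :: nat
    by (induction x) auto
  ultimately show "recursive2 (*)" by simp
qed

lemma recursive_power:
  assumes "recursive k f" "recursive k g"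
  shows "recursive k (\<lambda>xs. f xs ^ g xs)"
proof (rule recursive_comp2[OF _ assms])
  have "recursive2 (\<lambda>x y. rec_nat 1 (\<lambda>_ r. x * r) y)"
    by (intro recursive_rec_nat recursive_const recursive_mult recursive_vars) auto
  moreover have "rec_nat 1 (\<lambda>_ r. x * r) y = x ^ y" for x y :: nat
    by (induction y) auto
  ultimately show "recursive2 (^)" by simp
qed

lemma recursive_if:
  assumes "decidable k P" "recursive k f" "recursive k g"
  shows "recursive k (\<lambda>xs. if P xs then f xs else g xs)"
proof -
  let ?c = "\<lambda>xs. if P xs then 1 else 0 :: nat"
  have "recursive k (\<lambda>xs. ?c xs * f xs + (1 - ?c xs) * g xs)"
    using assms unfolding decidable_def
    by (intro recursive_add recursive_mult recursive_diff recursive_const)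
  then show ?thesis by (rule recursive_cong) simp
qed

lemma decidable_eq_0:
  assumes "recursive k f"
  shows "decidable k (\<lambda>xs. f xs = 0)"
  unfolding decidable_def
  by (rule recursive_cong[OF recursive_diff[OF recursive_const[of _ 1] assms]]) auto

lemma decidable_le:
  assumes "recursive k f" "recursive k g"
  shows "decidable k (\<lambda>xs. f xs \<le> g xs)"
  using decidable_eq_0[OF recursive_diff[OF assms]] by simp

lemma decidable_less:
  assumes "recursive k f" "recursive k g"
  shows "decidable k (\<lambda>xs. f xs < g xs)"
  using decidable_le[OF recursive_Suc[OF assms(1)] assms(2)] by (simp add: Suc_le_eq)

lemma decidable_not:
  assumes "decidable k P"
  shows "decidable k (\<lambda>xs. \<not> P xs)"
proof -
  have "((if P xs then 1 else 0) = (0 :: nat)) = (\<not> P xs)" for xs by simp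
  then show ?thesis using decidable_eq_0[OF assms[unfolded decidable_def]] by simp
qed

lemma decidable_conj:
  assumes "decidable k P" "decidable k Q"
  shows "decidable k (\<lambda>xs. P xs \<and> Q xs)"
  unfolding decidable_def
  by (rule recursive_cong[OF recursive_mult[OF assms[unfolded decidable_def]]]) auto

lemma decidable_imp:
  assumes "decidable k P" "decidable k Q"
  shows "decidable k (\<lambda>xs. P xs \<longrightarrow> Q xs)"
  using decidable_not[OF decidable_conj[OF assms(1) decidable_not[OF assms(2)]]] by simp

lemma decidable_eq:
  assumes "recursive k f" "recursive k g"
  shows "decidable k (\<lambda>xs. f xs = g xs)"
  using decidable_conj[OF decidable_le[OF assms] decidable_le[OF assms(2,1)]]
  by (simp add: order_eq_iff)

lemma decidable_ex_less:
  assumes "decidable (Suc k) (\<lambda>ys. P (hd ys) (tl ys))" "recursive k b"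
  shows "decidable k (\<lambda>xs. \<exists>i<b xs. P i xs)"
proof -
  obtain q where q: "\<And>ys. length ys = Suc k \<Longrightarrow>
      computes q ys (if P (hd ys) (tl ys) then 1 else 0)"
    using assms(1) by (auto simp: decidable_def recursive_def)
  \<comment> \<open>The step function of a recursion receives the counter, the value so far and then
    \<open>xs\<close>; the entry in between must be skipped before \<open>P\<close> applies.\<close>
  have "decidable (Suc (Suc k)) (\<lambda>ys. P (hd ys) (tl (tl ys)))"
  proof -
    let ?gs = "(\<lambda>ys. hd ys) # map (\<lambda>i ys. ys ! Suc (Suc i)) [0..<k]"
    let ?f = "\<lambda>ys. if P (hd ys) (tl ys) then 1 else 0 :: nat"
    have "recursive (Suc (Suc k)) (\<lambda>ys. ?f (map (\<lambda>g. g ys) ?gs))"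
      using assms(1)
      by (intro recursive_comp) (auto simp: decidable_def intro: recursive_nth recursive_vars)
    moreover have "map (\<lambda>i. ys ! Suc (Suc i)) [0..<k] = tl (tl ys)"
      if "length ys = Suc (Suc k)" for ys :: "nat list"
      using that by (auto simp: nth_tl intro!: nth_equalityI)
    ultimately show ?thesis
      unfolding decidable_def by (auto simp: comp_def elim: recursive_cong)
  qed
  then have "recursive k (\<lambda>xs. rec_nat 0 (\<lambda>n r. if P n xs then 1 else r) (b xs))"
    by (intro recursive_rec_nat recursive_if recursive_const recursive_vars assms(2)) auto
  moreover have "rec_nat 0 (\<lambda>n r. if P n xs then 1 else r) m = (if \<exists>i<m. P i xs then 1 else 0 :: nat)"
    for m xs by (induction m) (auto simp: less_Suc_eq)
  ultimately show ?thesis by (simp add: decidable_def)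
qed

lemma decidable_all_less:
  assumes "decidable (Suc k) (\<lambda>ys. P (hd ys) (tl ys))" "recursive k b"
  shows "decidable k (\<lambda>xs. \<forall>i<b xs. P i xs)"
  using decidable_not[OF decidable_ex_less[OF decidable_not[OF assms(1)] assms(2)]] by simp

text \<open>With these rules a predicate built from arithmetic, connectives and bounded quantifiers
  is proved decidable by following its syntax.\<close>

lemmas recursive_intros = recursive_vars recursive_const recursive_Suc recursive_add recursive_diff
  recursive_mult recursive_power recursive_if decidable_le decidable_less decidable_eq
  decidable_not decidable_conj decidable_imp decidable_ex_less decidable_all_less

section \<open>Decoding of pairs, lists and finite sets\<close>

lemma two_mult_prod_encode:
  "2 * prod_encode (x, y) = (x + y) * Suc (x + y) + 2 * x"
proof -
  have "2 * triangle n = n * Suc n" for n by (induction n) auto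
  then show ?thesis by (simp add: prod_encode_def)
qed

text \<open>Doubling clears the division by 2 in the triangular number, so the graph of the pairing
  function becomes a polynomial equation.\<close>

lemma prod_encode_eq_iff:
  "prod_encode (x, y) = z \<longleftrightarrow> (x + y) * Suc (x + y) + 2 * x = 2 * z"
  using two_mult_prod_encode[of x y] by auto

text \<open>Injectivity of the pairing makes the solution unique, and both components are at most
  \<open>z\<close>. So one component is found by minimization while the other stays under a bounded
  quantifier.\<close>

lemma prod_decode_Least:
  "fst (prod_decode z) = (LEAST x. \<exists>y<Suc z. (x + y) * Suc (x + y) + 2 * x = 2 * z)"
  "snd (prod_decode z) = (LEAST y. \<exists>x<Suc z. (x + y) * Suc (x + y) + 2 * x = 2 * z)"
proof -
  obtain a b where ab: "prod_decode z = (a, b)" by fastforce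
  then have z: "z = prod_encode (a, b)" by (metis prod_decode_inverse)
  show "fst (prod_decode z) = (LEAST x. \<exists>y<Suc z. (x + y) * Suc (x + y) + 2 * x = 2 * z)"
    using le_prod_encode_2[of b a]
    unfolding prod_encode_eq_iff[symmetric]
    by (intro Least_equality[symmetric]) (auto simp: z less_Suc_eq_le)
  show "snd (prod_decode z) = (LEAST y. \<exists>x<Suc z. (x + y) * Suc (x + y) + 2 * x = 2 * z)"
    using le_prod_encode_1[of a b]
    unfolding prod_encode_eq_iff[symmetric]
    by (intro Least_equality[symmetric]) (auto simp: z less_Suc_eq_le)
qed

lemma ex_prod_encode:
  "\<exists>x. \<exists>y<Suc z. (x + y) * Suc (x + y) + 2 * x = 2 * z"
  "\<exists>y. \<exists>x<Suc z. (x + y) * Suc (x + y) + 2 * x = 2 * z"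
  unfolding prod_encode_eq_iff[symmetric] less_Suc_eq_le
  by (metis le_prod_encode_1 le_prod_encode_2 prod_decode_inverse surj_pair)+

lemma recursive_prod_decode:
  assumes "recursive k f"
  shows "recursive k (\<lambda>xs. fst (prod_decode (f xs)))" "recursive k (\<lambda>xs. snd (prod_decode (f xs)))"
  unfolding prod_decode_Least
  by (rule recursive_comp1[OF _ assms],
      (intro recursive_Least recursive_intros ex_prod_encode; simp))+

text \<open>\<open>list_encode\<close> codes a nonempty list by the successor of the pair of its
  head and the code of its tail, hence the subtraction of 1.\<close>

definition code_hd :: "nat \<Rightarrow> nat" where
  "code_hd c = fst (prod_decode (c - 1))"

definition code_drop :: "nat \<Rightarrow> nat \<Rightarrow> nat" where
  "code_drop i c = rec_nat c (\<lambda>_ r. snd (prod_decode (r - 1))) i"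

definition code_nth :: "nat \<Rightarrow> nat \<Rightarrow> nat" where
  "code_nth c i = code_hd (code_drop i c)"

text \<open>The bound \<open>c\<close> suffices because a list is never longer than its code; a
  nonzero \<open>code_drop i c\<close> says that position \<open>i\<close> lies inside the
  list.\<close>

definition code_mem :: "nat \<Rightarrow> nat \<Rightarrow> bool" where
  "code_mem x c \<longleftrightarrow> (\<exists>i<c. code_drop i c \<noteq> 0 \<and> code_nth c i = x)"

lemma recursive_code_drop:
  assumes "recursive k f" "recursive k g"
  shows "recursive k (\<lambda>xs. code_drop (f xs) (g xs))"
  unfolding code_drop_def
  by (rule recursive_comp2[OF _ assms])
    (intro recursive_rec_nat recursive_prod_decode recursive_intros; simp)

lemma recursive_code_nth:
  assumes "recursive k f" "recursive k g"
  shows "recursive k (\<lambda>xs. code_nth (f xs) (g xs))"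
  unfolding code_nth_def code_hd_def
  by (intro recursive_prod_decode recursive_code_drop recursive_intros assms)

lemma decidable_comp2:
  assumes "decidable 2 (\<lambda>xs. P (hd xs) (hd (tl xs)))" "recursive k f" "recursive k g"
  shows "decidable k (\<lambda>xs. P (f xs) (g xs))"
  using recursive_comp2[of "\<lambda>x y. if P x y then 1 else 0", OF _ assms(2,3)] assms(1)
  by (simp add: decidable_def)

lemma decidable_code_mem:
  assumes "recursive k f" "recursive k g"
  shows "decidable k (\<lambda>xs. code_mem (f xs) (g xs))"
  unfolding code_mem_def
  by (rule decidable_comp2[OF _ assms])
    (intro recursive_code_drop recursive_code_nth recursive_intros; simp)

text \<open>Bit \<open>i\<close> is isolated by splitting \<open>Q\<close> into an odd multiple of
  \<open>2 ^ i\<close> and a remainder. This trades division and parity for bounded quantifiers over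
  sums, products and powers.\<close>

lemma mem_set_decode_iff:
  "i \<in> set_decode Q \<longleftrightarrow> (\<exists>q<Suc Q. \<exists>r<2 ^ i. Q = Suc (2 * q) * 2 ^ i + r)"
proof
  assume "i \<in> set_decode Q"
  then obtain q where q: "Q div 2 ^ i = Suc (2 * q)"
    by (auto simp: set_decode_def elim!: oddE)
  have "Q = Suc (2 * q) * 2 ^ i + Q mod 2 ^ i"
    using div_mult_mod_eq[of Q "2 ^ i"] q by simp
  moreover have "q < Suc Q"
    using q div_le_dividend[of Q "2 ^ i"] by linarith
  ultimately show "\<exists>q<Suc Q. \<exists>r<2 ^ i. Q = Suc (2 * q) * 2 ^ i + r"
    by (metis mod_less_divisor zero_less_numeral zero_less_power)
next
  assume "\<exists>q<Suc Q. \<exists>r<2 ^ i. Q = Suc (2 * q) * 2 ^ i + r"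
  then obtain q r where "r < 2 ^ i" "Q = Suc (2 * q) * 2 ^ i + r" by blast
  then have "Q div 2 ^ i = Suc (2 * q)" by (simp add: div_mult_self3 del: mult_Suc)
  then show "i \<in> set_decode Q" by (simp add: set_decode_def)
qed

lemma decidable_mem_set_decode:
  assumes "recursive k f" "recursive k g"
  shows "decidable k (\<lambda>xs. f xs \<in> set_decode (g xs))"
  unfolding mem_set_decode_iff
  by (rule decidable_comp2[OF _ assms]) (intro recursive_intros; simp)

lemma code_drop_list_encode: "code_drop i (list_encode xs) = list_encode (drop i xs)"
proof -
  \<comment> \<open>This makes dropping past the end of a list stay at 0, the code of the empty
    list.\<close>
  have "prod_decode 0 = (0, 0)"
    using prod_encode_inverse[of "(0, 0)"] by (simp add: prod_encode_def)
  then have "snd (prod_decode (list_encode ys - 1)) = list_encode (tl ys)" for ys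
    by (cases ys) auto
  then show ?thesis
    by (induction i) (auto simp: code_drop_def drop_Suc tl_drop)
qed

lemma code_nth_list_encode: "i < length xs \<Longrightarrow> code_nth (list_encode xs) i = xs ! i"
  by (auto simp: code_nth_def code_drop_list_encode code_hd_def simp flip: Cons_nth_drop_Suc)

lemma length_le_list_encode: "length xs \<le> list_encode xs"
proof (induction xs)
  case (Cons x xs)
  then show ?case using le_prod_encode_2[of "list_encode xs" x] by simp
qed simp

lemma code_mem_list_encode: "code_mem x (list_encode xs) \<longleftrightarrow> x \<in> set xs"
proof -
  have "code_drop i (list_encode xs) \<noteq> 0 \<longleftrightarrow> i < length xs" for i
    using list_encode_eq[of "drop i xs" "[]"] by (auto simp: code_drop_list_encode)
  then show ?thesis
    using length_le_list_encode[of xs]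
    by (auto simp: code_mem_def in_set_conv_nth code_nth_list_encode intro: less_le_trans)
qed

lemma code_nth_encode_table:
  assumes "i < m" "j < k"
  shows "code_nth (code_nth (encode_table g m k) i) j = g i j"
  using assms by (simp add: encode_table_def code_nth_list_encode)

section \<open>Embeddings of forests\<close>

text \<open>Deletion of nodes is presented by recursion on the first root of the larger forest,
  because each rule then translates into one condition on pairs of values in
  \<open>sigma1_definable_iff\<close>.\<close>

inductive embeds :: "'a forest \<Rightarrow> 'a forest \<Rightarrow> bool" where
  embeds_Nil: "embeds [] []"
| embeds_keep: "embeds f1 g1 \<Longrightarrow> embeds f2 g2 \<Longrightarrow> embeds (Node a f1 # f2) (Node a g1 # g2)"
| embeds_drop: "embeds f1 g1 \<Longrightarrow> embeds f2 g2 \<Longrightarrow> embeds (f1 @ f2) (Node a g1 # g2)"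

fun forest_size :: "'a forest \<Rightarrow> nat" where
  "forest_size [] = 0"
| "forest_size (Node a f # g) = Suc (forest_size f + forest_size g)"

text \<open>The hypotheses concern the children and the right siblings of the first root; this
  replaces the nested induction over trees and lists.\<close>

lemmas forest_induct = forest_size.induct[case_names Nil Cons]

lemma forest_size_append [simp]: "forest_size (f @ g) = forest_size f + forest_size g"
  by (induction f rule: forest_induct) auto

lemma embeds_empty: "embeds [] g"
proof (induction g rule: forest_induct)
  case (Cons a f g)
  then show ?case using embeds_drop[of "[]" f "[]" g a] by simp
qed (rule embeds_Nil)

lemma embeds_refl: "embeds f f"
  by (induction f rule: forest_induct) (auto intro: embeds.intros)

text \<open>Each use of \<open>embeds_drop\<close> loses a node. Hence a forest of least size is
  minimal, which gives \<open>ex_reduced\<close>.\<close>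

lemma embeds_size: "embeds f g \<Longrightarrow> f = g \<or> forest_size f < forest_size g"
  by (induction rule: embeds.induct) auto

section \<open>Node addresses in composed forests\<close>

definition shift :: "nat \<Rightarrow> node \<Rightarrow> node" where
  "shift n x = (case x of [] \<Rightarrow> [] | i # p \<Rightarrow> (n + i) # p)"

lemma shift_simps [simp]:
  "shift n [] = []" "shift n (i # p) = (n + i) # p"
  "shift n x = [] \<longleftrightarrow> x = []" "shift n x = shift n y \<longleftrightarrow> x = y"
  by (auto simp: shift_def split: list.splits)

lemma dfs_less_simps [simp]:
  "dfs_less [] y \<longleftrightarrow> y \<noteq> []" "\<not> dfs_less x []"
  "dfs_less (i # p) (j # q) \<longleftrightarrow> i < j \<or> i = j \<and> dfs_less p q"
  by (auto simp: dfs_less_def neq_Nil_conv)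

lemma dfs_less_irrefl [simp]: "\<not> dfs_less x x"
  by (induction x) auto

lemma dfs_less_trans: "dfs_less x y \<Longrightarrow> dfs_less y z \<Longrightarrow> dfs_less x z"
  unfolding dfs_less_def by (erule lexord_trans) (auto simp: trans_def)

lemma dfs_less_linear: "dfs_less x y \<or> x = y \<or> dfs_less y x"
  unfolding dfs_less_def
  using total_lexord[of "{(i, j). i < (j :: nat)}"] by (fastforce simp: total_on_def)

lemma dfs_less_asym: "dfs_less x y \<Longrightarrow> \<not> dfs_less y x"
  using dfs_less_trans dfs_less_irrefl by blast

lemma strict_prefix_Nil_left [simp]: "strict_prefix [] x \<longleftrightarrow> x \<noteq> []"
  by (auto simp: strict_prefix_def)

lemma shift_orders [simp]:
  "dfs_less (shift n x) (shift n y) \<longleftrightarrow> dfs_less x y"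
  "strict_prefix (shift n x) (shift n y) \<longleftrightarrow> strict_prefix x y"
  by (cases x; cases y; auto)+

lemma subtree_append:
  "subtree (f @ g) (i # p) =
     (if i < length f then subtree f (i # p) else subtree g ((i - length f) # p))"
  by (cases p) (auto simp: nth_append)

lemma subtree_Node:
  "p \<noteq> [] \<Longrightarrow> subtree (Node a f # g) (0 # p) = subtree f p"
  by (cases p) auto

lemma subtree_shift: "subtree (f @ g) (shift (length f) x) = subtree g x"
  by (cases x) (auto simp: subtree_append)

lemma Nil_notin_nodes [simp]: "[] \<notin> nodes f"
  by (simp add: nodes_def)

lemma nodes_ConsE:
  assumes "x \<in> nodes f"
  obtains i p where "x = i # p" "i < length f"
  using assms by (cases x; cases "tl x") (auto simp: nodes_def split: if_splits)

lemma nodes_Nil [simp]: "nodes [] = {}"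
  by (auto elim: nodes_ConsE)

lemma nodes_append: "nodes (f @ g) = nodes f \<union> shift (length f) ` nodes g"
proof (intro subset_antisym subsetI)
  fix x assume x: "x \<in> nodes (f @ g)"
  then obtain i p where ip: "x = i # p" by (rule nodes_ConsE)
  show "x \<in> nodes f \<union> shift (length f) ` nodes g"
  proof (cases "i < length f")
    case False
    then have "x = shift (length f) ((i - length f) # p)" using ip by simp
    moreover have "(i - length f) # p \<in> nodes g"
      using x ip False by (simp add: nodes_def subtree_append)
    ultimately show ?thesis by blast
  qed (use x ip in \<open>simp add: nodes_def subtree_append\<close>)
next
  fix x assume "x \<in> nodes f \<union> shift (length f) ` nodes g"
  then show "x \<in> nodes (f @ g)"
  proof (elim UnE imageE)
    assume x: "x \<in> nodes f"
    then obtain i p where "x = i # p" "i < length f" by (rule nodes_ConsE)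
    with x show ?thesis by (simp add: nodes_def subtree_append)
  qed (simp add: nodes_def subtree_shift)
qed

lemma nodes_singleton: "nodes [Node a f] = insert [0] ((#) 0 ` nodes f)"
proof (intro subset_antisym subsetI)
  fix x assume x: "x \<in> nodes [Node a f]"
  then obtain p where "x = 0 # p" by (auto elim: nodes_ConsE)
  then show "x \<in> insert [0] ((#) 0 ` nodes f)"
    using x by (cases "p = []") (auto simp: nodes_def subtree_Node)
next
  fix x assume "x \<in> insert [0] ((#) 0 ` nodes f)"
  then show "x \<in> nodes [Node a f]"
  proof (elim insertE imageE)
    fix p assume "x = 0 # p" "p \<in> nodes f"
    then show ?thesis by (cases "p = []") (auto simp: nodes_def subtree_Node)
  qed (simp add: nodes_def)
qed

lemma nodes_Cons: "nodes (Node a f # g) = insert [0] ((#) 0 ` nodes f \<union> shift 1 ` nodes g)"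
  using nodes_append[of "[Node a f]" g] by (simp add: nodes_singleton)

lemma finite_nodes: "finite (nodes f)"
  by (induction f rule: forest_induct) (auto simp: nodes_Cons)

lemma label_at_append:
  "x \<in> nodes f \<Longrightarrow> label_at (f @ g) x = label_at f x"
  by (erule nodes_ConsE) (simp add: label_at_def subtree_append)

lemma label_at_shift: "label_at (f @ g) (shift (length f) x) = label_at g x"
  by (simp add: label_at_def subtree_shift)

lemma label_at_Cons:
  "label_at (Node a f # g) [0] = a"
  "x \<in> nodes f \<Longrightarrow> label_at (Node a f # g) (0 # x) = label_at f x"
  "label_at (Node a f # g) (shift 1 y) = label_at g y"
proof -
  show "label_at (Node a f # g) [0] = a" by (simp add: label_at_def)
  show "label_at (Node a f # g) (0 # x) = label_at f x" if "x \<in> nodes f"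
    using that by (cases "x = []") (auto simp: label_at_def subtree_Node)
  show "label_at (Node a f # g) (shift 1 y) = label_at g y"
    using label_at_shift[of "[Node a f]" g y] by simp
qed

section \<open>Embeddings as maps between nodes\<close>

definition embedding :: "(node \<Rightarrow> node) \<Rightarrow> 'a forest \<Rightarrow> 'a forest \<Rightarrow> bool" where
  "embedding \<phi> f g \<longleftrightarrow>
     (\<forall>x \<in> nodes f. \<phi> x \<in> nodes g \<and> label_at g (\<phi> x) = label_at f x) \<and>
     (\<forall>x \<in> nodes f. \<forall>y \<in> nodes f. (dfs_less x y \<longrightarrow> dfs_less (\<phi> x) (\<phi> y)) \<and>
        (strict_prefix (\<phi> x) (\<phi> y) \<longleftrightarrow> strict_prefix x y))"

lemma embedding_node: "embedding \<phi> f g \<Longrightarrow> x \<in> nodes f \<Longrightarrow> \<phi> x \<in> nodes g"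
  and embedding_label: "embedding \<phi> f g \<Longrightarrow> x \<in> nodes f \<Longrightarrow> label_at g (\<phi> x) = label_at f x"
  and embedding_prefix: "embedding \<phi> f g \<Longrightarrow> x \<in> nodes f \<Longrightarrow> y \<in> nodes f \<Longrightarrow>
    strict_prefix (\<phi> x) (\<phi> y) \<longleftrightarrow> strict_prefix x y"
  by (auto simp: embedding_def)

text \<open>The traversal order is linear, so preserving it strictly also reflects it. The ancestor
  order is not linear, which is why \<open>embedding\<close> demands an equivalence for it.\<close>

lemma embedding_dfs_less:
  assumes "embedding \<phi> f g" "x \<in> nodes f" "y \<in> nodes f"
  shows "dfs_less (\<phi> x) (\<phi> y) \<longleftrightarrow> dfs_less x y"
  using assms dfs_less_linear[of x y] dfs_less_asym[of "\<phi> x" "\<phi> y"]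
  unfolding embedding_def by (metis dfs_less_irrefl)

lemma embedding_inject:
  assumes "embedding \<phi> f g" "x \<in> nodes f" "y \<in> nodes f"
  shows "\<phi> x = \<phi> y \<longleftrightarrow> x = y"
  using assms dfs_less_linear[of x y] embedding_dfs_less by (metis dfs_less_irrefl)

lemma embedding_append_left: "embedding id f (f @ g)"
  by (auto simp: embedding_def nodes_append label_at_append)

lemma embedding_append_right: "embedding (shift (length f)) g (f @ g)"
  by (auto simp: embedding_def nodes_append label_at_shift)

lemma embedding_children: "embedding ((#) 0) f (Node a f # g)"
  by (auto simp: embedding_def nodes_Cons label_at_Cons)

lemma embedding_siblings: "embedding (shift 1) g (Node a f # g)"
  using embedding_append_right[of "[Node a f]" g] by simp

text \<open>The map is \<open>\<phi>\<close> after \<open>\<iota>\<close>, pulled back along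
  \<open>\<kappa>\<close>, which reflects labels and both orders. It restricts an embedding to a
  part of \<open>f\<close> that lands in a part of \<open>g\<close>.\<close>

lemma embedding_factor:
  assumes \<phi>: "embedding \<phi> f g" and \<iota>: "embedding \<iota> f' f" and \<kappa>: "embedding \<kappa> g' g"
    and into: "\<And>x. x \<in> nodes f' \<Longrightarrow> \<phi> (\<iota> x) \<in> \<kappa> ` nodes g'"
  shows "\<exists>\<psi>. embedding \<psi> f' g'"
proof -
  obtain \<psi> where \<psi>: "\<And>x. x \<in> nodes f' \<Longrightarrow> \<psi> x \<in> nodes g' \<and> \<kappa> (\<psi> x) = \<phi> (\<iota> x)"
    using into unfolding image_iff by metis
  have "embedding \<psi> f' g'"
    unfolding embedding_def
  proof (intro conjI ballI impI)
    fix x assume x: "x \<in> nodes f'"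
    show "\<psi> x \<in> nodes g'" using \<psi> x by blast
    show "label_at g' (\<psi> x) = label_at f' x"
      using \<psi>[OF x] embedding_label[OF \<kappa>, of "\<psi> x"] embedding_label[OF \<phi>, of "\<iota> x"]
        embedding_label[OF \<iota> x] embedding_node[OF \<iota> x] by simp
    fix y assume y: "y \<in> nodes f'"
    note inner = embedding_node[OF \<iota> x] embedding_node[OF \<iota> y]
    show "strict_prefix (\<psi> x) (\<psi> y) \<longleftrightarrow> strict_prefix x y"
      using \<psi>[OF x] \<psi>[OF y] embedding_prefix[OF \<kappa>, of "\<psi> x" "\<psi> y"]
        embedding_prefix[OF \<phi> inner] embedding_prefix[OF \<iota> x y] by simp
    show "dfs_less (\<psi> x) (\<psi> y)" if "dfs_less x y"
      using \<psi>[OF x] \<psi>[OF y] embedding_dfs_less[OF \<kappa>, of "\<psi> x" "\<psi> y"]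
        embedding_dfs_less[OF \<phi> inner] embedding_dfs_less[OF \<iota> x y] that by simp
  qed
  then show ?thesis by blast
qed

lemma embeds_imp_embedding: "embeds f g \<Longrightarrow> \<exists>\<phi>. embedding \<phi> f g"
proof (induction rule: embeds.induct)
  case embeds_Nil
  show ?case by (simp add: embedding_def)
next
  case (embeds_keep f1 g1 f2 g2 a)
  then obtain \<phi>1 \<phi>2 where \<phi>: "embedding \<phi>1 f1 g1" "embedding \<phi>2 f2 g2" by blast
  \<comment> \<open>Nodes below the first root follow \<open>\<phi>1\<close> under the prefix 0,
    later trees follow \<open>\<phi>2\<close> moved by one position; the test \<open>p = []\<close>
    sends the first root to itself.\<close>
  define \<phi> where "\<phi> x = (case x of [] \<Rightarrow> [] | 0 # p \<Rightarrow> 0 # (if p = [] then [] else \<phi>1 p)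
    | Suc i # p \<Rightarrow> shift 1 (\<phi>2 (i # p)))" for x
  have \<phi>_simps: "\<phi> [0] = [0]" "\<And>x. x \<in> nodes f1 \<Longrightarrow> \<phi> (0 # x) = 0 # \<phi>1 x"
    "\<And>y. y \<in> nodes f2 \<Longrightarrow> \<phi> (shift 1 y) = shift 1 (\<phi>2 y)"
    by (auto simp: \<phi>_def elim!: nodes_ConsE)
  have ne: "\<And>x. x \<in> nodes f1 \<Longrightarrow> x \<noteq> [] \<and> \<phi>1 x \<noteq> []" "\<And>y. y \<in> nodes f2 \<Longrightarrow> y \<noteq> [] \<and> \<phi>2 y \<noteq> []"
    using \<phi>[THEN embedding_node] by (metis Nil_notin_nodes)+
  have across: "dfs_less (0 # p) (shift 1 y)" "\<not> dfs_less (shift 1 y) (0 # p)"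
      "\<not> strict_prefix (0 # p) (shift 1 y)" "\<not> strict_prefix (shift 1 y) (0 # p)"
    if "y \<noteq> []" for p y using that by (cases y; simp)+
  have "embedding \<phi> (Node a f1 # f2) (Node a g1 # g2)"
    unfolding embedding_def nodes_Cons
    using ne \<phi>[THEN embedding_node]
    by (auto simp del: One_nat_def simp: \<phi>_simps label_at_Cons across
      \<phi>[THEN embedding_label] \<phi>[THEN embedding_prefix] \<phi>[THEN embedding_dfs_less])
  then show ?case by blast
next
  case (embeds_drop f1 g1 f2 g2 a)
  then obtain \<phi>1 \<phi>2 where \<phi>: "embedding \<phi>1 f1 g1" "embedding \<phi>2 f2 g2" by blast
  \<comment> \<open>The trees of \<open>f1\<close> land below the first root of the larger forest,
    hence the prefix 0; the others are renumbered as trees of \<open>f2\<close> and land to its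
    right.\<close>
  define \<phi> where "\<phi> x = (if hd x < length f1 then 0 # \<phi>1 x
    else shift 1 (\<phi>2 ((hd x - length f1) # tl x)))" for x
  have \<phi>_simps: "\<And>x. x \<in> nodes f1 \<Longrightarrow> \<phi> x = 0 # \<phi>1 x"
    "\<And>y. y \<in> nodes f2 \<Longrightarrow> \<phi> (shift (length f1) y) = shift 1 (\<phi>2 y)"
    by (auto simp: \<phi>_def elim!: nodes_ConsE)
  have ne: "\<And>y. y \<in> nodes f2 \<Longrightarrow> y \<noteq> [] \<and> \<phi>2 y \<noteq> []"
    using \<phi>[THEN embedding_node] by (metis Nil_notin_nodes)
  have across: "dfs_less (0 # p) (shift 1 y)" "\<not> dfs_less (shift 1 y) (0 # p)"
      "\<not> strict_prefix (0 # p) (shift 1 y)" "\<not> strict_prefix (shift 1 y) (0 # p)"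
    if "y \<noteq> []" for p y using that by (cases y; simp)+
  have across': "dfs_less x (shift (length f1) y)" "\<not> dfs_less (shift (length f1) y) x"
      "\<not> strict_prefix x (shift (length f1) y)" "\<not> strict_prefix (shift (length f1) y) x"
    if "x \<in> nodes f1" "y \<noteq> []" for x y
    using that by (cases y; auto elim!: nodes_ConsE)+
  have "embedding \<phi> (f1 @ f2) (Node a g1 # g2)"
    unfolding embedding_def nodes_Cons nodes_append
    using ne \<phi>[THEN embedding_node]
    by (auto simp del: One_nat_def simp: \<phi>_simps label_at_Cons across across'
      label_at_append label_at_shift \<phi>[THEN embedding_label] \<phi>[THEN embedding_prefix] \<phi>[THEN embedding_dfs_less])
  then show ?case by blast
qed

lemma root_in_nodes: "i < length f \<Longrightarrow> [i] \<in> nodes f"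
  by (simp add: nodes_def)

text \<open>If the first root is sent to the first root, its descendants go below that root and all
  other nodes to its right. Otherwise the first root of \<open>g\<close> is missed, and
  \<open>f\<close> splits into initial trees that land below it and later trees that land to its
  right.\<close>

lemma embedding_imp_embeds: "embedding \<phi> f g \<Longrightarrow> embeds f g"
proof (induction g arbitrary: \<phi> f rule: forest_induct)
  case Nil
  then have "f = []" using root_in_nodes[of 0 f] by (auto simp: embedding_def)
  then show ?case by (simp add: embeds_Nil)
next
  case (Cons a g1 g2)
  note \<phi> = Cons.prems
  have cases: "\<phi> x = [0] \<or> \<phi> x \<in> (#) 0 ` nodes g1 \<or> \<phi> x \<in> shift 1 ` nodes g2" if "x \<in> nodes f" for x
    using embedding_node[OF \<phi> that] by (auto simp: nodes_Cons)
  have into1: "embeds f' g1"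
    if "embedding \<iota> f' f" "\<And>x. x \<in> nodes f' \<Longrightarrow> \<phi> (\<iota> x) \<in> (#) 0 ` nodes g1" for \<iota> f'
    using Cons.IH(1) embedding_factor[OF \<phi> that(1) embedding_children that(2)] by blast
  have into2: "embeds f' g2"
    if "embedding \<iota> f' f" "\<And>x. x \<in> nodes f' \<Longrightarrow> \<phi> (\<iota> x) \<in> shift 1 ` nodes g2" for \<iota> f'
    using Cons.IH(2) embedding_factor[OF \<phi> that(1) embedding_siblings that(2)] by blast
  have right: "strict_prefix [0] y \<longleftrightarrow> False" "hd y > 0" if "y \<in> shift 1 ` nodes g2" for y
    using that by (auto elim!: nodes_ConsE)
  have left: "strict_prefix [0] y" "hd y = 0" if "y \<in> (#) 0 ` nodes g1" for y
    using that by (auto elim!: nodes_ConsE)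
  show ?case
  proof (cases "f \<noteq> [] \<and> \<phi> [0] = [0]")
    case True
    then obtain b f1 f2 where f: "f = Node b f1 # f2" by (metis list.exhaust tree.exhaust)
    have root: "[0] \<in> nodes f" using f by (simp add: root_in_nodes)
    have "a = b" using embedding_label[OF \<phi> root] True f by (simp add: label_at_Cons)
    moreover have "embeds f1 g1"
    proof (rule into1)
      show "embedding ((#) 0) f1 f" unfolding f by (rule embedding_children)
      fix x assume x: "x \<in> nodes f1"
      then have x': "0 # x \<in> nodes f" "x \<noteq> []" by (auto simp: f nodes_Cons)
      then have "strict_prefix [0] (\<phi> (0 # x))"
        using embedding_prefix[OF \<phi> root, of "0 # x"] True by (simp add: strict_prefix_def)
      then show "\<phi> (0 # x) \<in> (#) 0 ` nodes g1" using cases[OF x'(1)] right(1) by auto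
    qed
    moreover have "embeds f2 g2"
    proof (rule into2)
      show "embedding (shift 1) f2 f" unfolding f by (rule embedding_siblings)
      fix x assume x: "x \<in> nodes f2"
      then have x': "shift 1 x \<in> nodes f" by (auto simp: f nodes_Cons)
      have "\<not> strict_prefix [0] (shift 1 x)" "shift 1 x \<noteq> [0]" using x by (auto elim!: nodes_ConsE)
      then have "\<not> strict_prefix [0] (\<phi> (shift 1 x))" "\<phi> (shift 1 x) \<noteq> [0]"
        using embedding_prefix[OF \<phi> root x'] embedding_inject[OF \<phi> x' root] True by auto
      then show "\<phi> (shift 1 x) \<in> shift 1 ` nodes g2" using cases[OF x'] left(1) by auto
    qed
    ultimately show ?thesis using f by (auto intro: embeds_keep)
  next
    case False
    \<comment> \<open>The address \<open>[0]\<close> comes first in the traversal of both forests,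
      so if any node were sent to \<open>[0]\<close>, the first node of \<open>f\<close> would
      be.\<close>
    have no_root: "\<phi> x \<noteq> [0]" if x: "x \<in> nodes f" for x
    proof
      assume "\<phi> x = [0]"
      moreover have "[0] \<in> nodes f" using x by (auto elim!: nodes_ConsE intro: root_in_nodes)
      moreover from this have "\<phi> [0] \<noteq> [0]" using False by auto
      moreover have "\<phi> [0] \<noteq> []" using embedding_node[OF \<phi>] calculation by fastforce
      moreover have "x = [0] \<or> dfs_less [0] x" using x by (auto elim!: nodes_ConsE)
      ultimately show False using embedding_dfs_less[OF \<phi>, of "[0]" x] x
        by (cases "\<phi> [0]") auto
    qed
    \<comment> \<open>The number of initial trees of \<open>f\<close> whose roots land below the
      first root of \<open>g\<close>; the disjunct \<open>i = length f\<close> ensures that the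
      minimum exists.\<close>
    define i where "i = (LEAST i. i = length f \<or> \<phi> [i] \<notin> (#) 0 ` nodes g1)"
    have i: "i = length f \<or> \<phi> [i] \<notin> (#) 0 ` nodes g1"
      unfolding i_def by (rule LeastI) blast
    have i_le: "i \<le> length f" unfolding i_def by (rule Least_le) blast
    have below: "\<phi> [j] \<in> (#) 0 ` nodes g1" if "j < i" for j
      using not_less_Least[OF that[unfolded i_def]] by blast
    have "embeds (take i f) g1"
    proof (rule into1)
      show "embedding id (take i f) f"
        using embedding_append_left[of "take i f" "drop i f"] by simp
      fix x assume x: "x \<in> nodes (take i f)"
      then have xf: "x \<in> nodes f" using nodes_append[of "take i f" "drop i f"] by auto
      obtain j p where jp: "x = j # p" "j < i" using x by (auto elim: nodes_ConsE)
      then have jf: "[j] \<in> nodes f" using i_le by (simp add: root_in_nodes)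
      have "p = [] \<or> strict_prefix (\<phi> [j]) (\<phi> x)"
        using embedding_prefix[OF \<phi> jf xf] jp by (auto simp: strict_prefix_def)
      then have "hd (\<phi> x) = 0"
        using below[OF jp(2)] jp(1) by (auto simp: strict_prefix_def prefix_def)
      then show "\<phi> (id x) \<in> (#) 0 ` nodes g1" using cases[OF xf] no_root[OF xf]
        right(2)[of "\<phi> x"] by auto
    qed
    moreover have "embeds (drop i f) g2"
    proof (rule into2)
      have len: "length (take i f) = i" using i_le by simp
      show "embedding (shift i) (drop i f) f"
        using embedding_append_right[of "take i f" "drop i f"] len by simp
      fix x assume x: "x \<in> nodes (drop i f)"
      then have xf: "shift i x \<in> nodes f"
        using nodes_append[of "take i f" "drop i f"] len by auto
      obtain j p where jp: "x = j # p" "i < length f" using x by (auto elim: nodes_ConsE)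
      then have iroot: "[i] \<in> nodes f" by (simp add: root_in_nodes)
      have pos: "hd (\<phi> [i]) > 0" using cases[OF iroot] no_root[OF iroot] i jp(2) right(2) by blast
      \<comment> \<open>Nodes from tree \<open>i\<close> onward do not precede \<open>[i]\<close> in
        the traversal, so their images do not precede \<open>\<phi> [i]\<close>, which lies to the
        right of the first tree of \<open>g\<close>.\<close>
      have "shift i x = [i] \<or> dfs_less [i] (shift i x)" using jp by (cases p) auto
      then have "\<phi> (shift i x) = \<phi> [i] \<or> dfs_less (\<phi> [i]) (\<phi> (shift i x))"
        using embedding_dfs_less[OF \<phi> iroot xf] by auto
      moreover have "\<phi> [i] \<noteq> []" "\<phi> (shift i x) \<noteq> []"
        using embedding_node[OF \<phi>] iroot xf Nil_notin_nodes by metis+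
      ultimately have "hd (\<phi> (shift i x)) > 0"
        using pos by (cases "\<phi> [i]"; cases "\<phi> (shift i x)") auto
      then show "\<phi> (shift i x) \<in> shift 1 ` nodes g2"
        using cases[OF xf] no_root[OF xf] left(2) by fastforce
    qed
    ultimately have "embeds (take i f @ drop i f) (Node a g1 # g2)" by (rule embeds_drop)
    then show ?thesis by simp
  qed
qed

lemma forests_Nil [simp]: "[] \<in> forests A"
  by (simp add: forests_def)

lemma forests_Cons [simp]:
  "Node a f # g \<in> forests A \<longleftrightarrow> a \<in> A \<and> f \<in> forests A \<and> g \<in> forests A"
  by (auto simp: forests_def)

lemma forests_append [simp]: "f @ g \<in> forests A \<longleftrightarrow> f \<in> forests A \<and> g \<in> forests A"
  by (auto simp: forests_def)

lemma label_at_in: "f \<in> forests A \<Longrightarrow> x \<in> nodes f \<Longrightarrow> label_at f x \<in> A"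
  by (induction f arbitrary: x rule: forest_induct) (auto simp: nodes_Cons label_at_Cons simp del: One_nat_def)

lemma embeds_forests: "embeds f g \<Longrightarrow> g \<in> forests A \<Longrightarrow> f \<in> forests A"
  by (induction rule: embeds.induct) auto

text \<open>Node maps compose at once, whereas the rules of \<open>embeds\<close> split the smaller
  forest and are awkward to chain.\<close>

lemma embeds_trans:
  assumes "embeds f g" "embeds g h"
  shows "embeds f h"
proof -
  obtain \<phi> \<psi> where *: "embedding \<phi> f g" "embedding \<psi> g h"
    using assms embeds_imp_embedding by metis
  have "embedding (\<psi> \<circ> \<phi>) f h"
    using * unfolding embedding_def[of "\<psi> \<circ> \<phi>"]
    by (auto simp: embedding_node embedding_label embedding_prefix embedding_dfs_less)
  then show ?thesis by (rule embedding_imp_embeds)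
qed

section \<open>Upward closure of definable languages\<close>

definition embeds_closed :: "'a set \<Rightarrow> 'a forest set \<Rightarrow> bool" where
  "embeds_closed A L \<longleftrightarrow> (\<forall>f \<in> L. \<forall>g \<in> forests A. embeds f g \<longrightarrow> g \<in> L)"

text \<open>Every atom is preserved and reflected, so the equivalence passes through
  negations.\<close>

lemma holds_embedding:
  assumes "embedding \<phi> f g"
  shows "\<nu> ` qf_vars \<gamma> \<subseteq> nodes f \<Longrightarrow> holds g (\<phi> \<circ> \<nu>) \<gamma> \<longleftrightarrow> holds f \<nu> \<gamma>"
  by (induction \<gamma>)
    (auto simp: embedding_inject[OF assms] embedding_label[OF assms] embedding_prefix[OF assms]
      embedding_dfs_less[OF assms])

lemma holds_cong: "(\<And>i. i \<in> qf_vars \<gamma> \<Longrightarrow> \<nu> i = \<mu> i) \<Longrightarrow> holds f \<nu> \<gamma> \<longleftrightarrow> holds f \<mu> \<gamma>"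
  by (induction \<gamma>) auto

lemma satisfies_embeds:
  assumes "embeds f g" "sigma1_sentence A \<phi>" "satisfies f \<phi>"
  shows "satisfies g \<phi>"
proof -
  obtain n \<gamma> where \<phi>: "\<phi> = Exists n \<gamma>" by (cases \<phi>)
  obtain \<nu> where \<nu>: "\<forall>i<n. \<nu> i \<in> nodes f" "holds f \<nu> \<gamma>" using assms(3) \<phi> by auto
  obtain \<eta> where \<eta>: "embedding \<eta> f g" using assms(1) embeds_imp_embedding by blast
  have "holds g (\<eta> \<circ> \<nu>) \<gamma>"
    using holds_embedding[OF \<eta>, of \<nu> \<gamma>] \<nu> assms(2) \<phi> by auto
  then show ?thesis
    using \<nu>(1) embedding_node[OF \<eta>] \<phi> by (auto intro!: exI[of _ "\<eta> \<circ> \<nu>"])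
qed

lemma sigma1_definable_imp_embeds_closed: "sigma1_definable A L \<Longrightarrow> embeds_closed A L"
  unfolding sigma1_definable_def embeds_closed_def by (auto intro: satisfies_embeds)

section \<open>Definability of upward closed languages\<close>

definition Conj :: "'a qf list \<Rightarrow> 'a qf" where
  "Conj \<gamma>s = foldr And \<gamma>s Tru"

definition Disj :: "'a qf list \<Rightarrow> 'a qf" where
  "Disj \<gamma>s = foldr Or \<gamma>s (Neg Tru)"

lemma Conj_simps [simp]:
  "holds f \<nu> (Conj \<gamma>s) \<longleftrightarrow> (\<forall>\<gamma> \<in> set \<gamma>s. holds f \<nu> \<gamma>)"
  "qf_vars (Conj \<gamma>s) = (\<Union>\<gamma> \<in> set \<gamma>s. qf_vars \<gamma>)"
  "set_qf (Conj \<gamma>s) = (\<Union>\<gamma> \<in> set \<gamma>s. set_qf \<gamma>)"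
  by (induction \<gamma>s) (auto simp: Conj_def)

lemma Disj_simps [simp]:
  "holds f \<nu> (Disj \<gamma>s) \<longleftrightarrow> (\<exists>\<gamma> \<in> set \<gamma>s. holds f \<nu> \<gamma>)"
  "qf_vars (Disj \<gamma>s) = (\<Union>\<gamma> \<in> set \<gamma>s. qf_vars \<gamma>)"
  "set_qf (Disj \<gamma>s) = (\<Union>\<gamma> \<in> set \<gamma>s. set_qf \<gamma>)"
  by (induction \<gamma>s) (auto simp: Disj_def)

text \<open>Variable \<open>i\<close> stands for the node \<open>xs ! i\<close>. The conjuncts
  mirror the clauses of \<open>embedding\<close>, so that a satisfying assignment is the same thing
  as an embedding of \<open>f\<close>.\<close>

definition diagram :: "'a forest \<Rightarrow> node list \<Rightarrow> 'a qf" where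
  "diagram f xs = Conj (concat (map (\<lambda>i. Label (label_at f (xs ! i)) i #
     concat (map (\<lambda>j. [if dfs_less (xs ! i) (xs ! j) then Dfs i j else Tru,
       if strict_prefix (xs ! i) (xs ! j) then Anc i j else Neg (Anc i j)])
     [0..<length xs])) [0..<length xs]))"

lemma holds_diagram:
  "holds g \<nu> (diagram f xs) \<longleftrightarrow>
     (\<forall>i<length xs. label_at g (\<nu> i) = label_at f (xs ! i) \<and>
       (\<forall>j<length xs. (dfs_less (xs ! i) (xs ! j) \<longrightarrow> dfs_less (\<nu> i) (\<nu> j)) \<and>
         (strict_prefix (\<nu> i) (\<nu> j) \<longleftrightarrow> strict_prefix (xs ! i) (xs ! j))))"
proof -
  have "holds g \<nu> (if P then Dfs i j else Tru) \<longleftrightarrow> (P \<longrightarrow> dfs_less (\<nu> i) (\<nu> j))"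
    "holds g \<nu> (if P then Anc i j else Neg (Anc i j)) \<longleftrightarrow> (strict_prefix (\<nu> i) (\<nu> j) \<longleftrightarrow> P)"
    for P i j by auto
  then show ?thesis by (simp add: diagram_def split del: if_split) (simp add: Ball_def)
qed

lemma qf_vars_diagram: "qf_vars (diagram f xs) \<subseteq> {..<length xs}"
  by (auto simp: diagram_def split: if_splits)

lemma set_qf_diagram:
  assumes "f \<in> forests A" "set xs \<subseteq> nodes f"
  shows "set_qf (diagram f xs) \<subseteq> A"
  using assms label_at_in[OF assms(1)]
  by (auto simp: diagram_def subset_iff split: if_splits)

lemma satisfies_diagram_iff:
  assumes "set xs = nodes f"
  shows "satisfies g (Exists (length xs) (diagram f xs)) \<longleftrightarrow> embeds f g"
proof
  assume "embeds f g"
  then obtain \<phi> where \<phi>: "embedding \<phi> f g" using embeds_imp_embedding by blast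
  then show "satisfies g (Exists (length xs) (diagram f xs))"
    using assms nth_mem[of _ xs]
    by (auto simp: holds_diagram embedding_def intro!: exI[of _ "\<lambda>i. \<phi> (xs ! i)"])
next
  assume "satisfies g (Exists (length xs) (diagram f xs))"
  then obtain \<nu> where \<nu>: "\<forall>i<length xs. \<nu> i \<in> nodes g" "holds g \<nu> (diagram f xs)" by auto
  have "\<forall>x \<in> nodes f. \<exists>i<length xs. xs ! i = x"
    using assms by (auto simp: in_set_conv_nth)
  then obtain \<iota> where "\<forall>x \<in> nodes f. \<iota> x < length xs \<and> xs ! \<iota> x = x"
    by metis
  then have "embedding (\<lambda>x. \<nu> (\<iota> x)) f g"
    using \<nu> unfolding holds_diagram embedding_def by metis
  then show "embeds f g" by (rule embedding_imp_embeds)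
qed

lemma embeds_Nil_right: "embeds f [] \<longleftrightarrow> f = []"
  using embeds_size[of f "[]"] embeds_Nil by auto

text \<open>All diagrams share one prefix of \<open>n\<close> quantifiers, so a small diagram leaves
  surplus variables that still need a node as value. Since \<open>[]\<close> is not in
  \<open>B\<close>, every model is nonempty and its first root can serve.\<close>

lemma sigma1_definable_finite_basis:
  fixes B :: "'a forest set"
  assumes "finite B" "B \<subseteq> forests A" "[] \<notin> B"
  shows "sigma1_definable A {g \<in> forests A. \<exists>b \<in> B. embeds b g}"
proof -
  obtain bs where bs: "set bs = B" using finite_list[OF assms(1)] by blast
  obtain xs :: "'a forest \<Rightarrow> node list" where xs: "\<And>b. set (xs b) = nodes b"
    using finite_list[OF finite_nodes] by metis
  define n where "n = (\<Sum>b \<in> B. length (xs b))"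
  have n: "length (xs b) \<le> n" if "b \<in> B" for b
    unfolding n_def by (rule member_le_sum[OF that _ assms(1)]) simp
  let ?\<gamma> = "Disj (map (\<lambda>b. diagram b (xs b)) bs)"
  have "sigma1_sentence A (Exists n ?\<gamma>)"
    using qf_vars_diagram n set_qf_diagram assms(2) xs bs by (fastforce simp: subset_iff)
  moreover have "satisfies g (Exists n ?\<gamma>) \<longleftrightarrow> (\<exists>b \<in> B. embeds b g)" for g
  proof
    assume "satisfies g (Exists n ?\<gamma>)"
    then obtain \<nu> b where "\<forall>i<n. \<nu> i \<in> nodes g" "b \<in> B" "holds g \<nu> (diagram b (xs b))"
      using bs by auto
    moreover from this have "satisfies g (Exists (length (xs b)) (diagram b (xs b)))"
      using n[of b] by (auto intro!: exI[of _ \<nu>])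
    ultimately show "\<exists>b \<in> B. embeds b g" using satisfies_diagram_iff[OF xs] by blast
  next
    assume "\<exists>b \<in> B. embeds b g"
    then obtain b where b: "b \<in> B" "embeds b g" by blast
    then obtain \<nu> where \<nu>: "\<forall>i<length (xs b). \<nu> i \<in> nodes g" "holds g \<nu> (diagram b (xs b))"
      using satisfies_diagram_iff[OF xs, of g b] by auto
    have "g \<noteq> []" using b assms(3) embeds_Nil_right[of b] by auto
    then have root: "[0] \<in> nodes g" by (simp add: root_in_nodes)
    let ?\<mu> = "\<lambda>i. if i < length (xs b) then \<nu> i else [0]"
    have "holds g ?\<mu> (diagram b (xs b)) \<longleftrightarrow> holds g \<nu> (diagram b (xs b))"
      by (rule holds_cong) (use qf_vars_diagram[of b "xs b"] in auto)
    then have "holds g ?\<mu> ?\<gamma>" using bs b(1) \<nu>(2) by auto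
    then show "satisfies g (Exists n ?\<gamma>)"
      using \<nu>(1) root unfolding satisfies.simps by (intro exI[of _ ?\<mu>]) auto
  qed
  ultimately show ?thesis unfolding sigma1_definable_def by blast
qed

text \<open>The depth of the binary tree that represents a forest by first children and next
  siblings.\<close>

fun binary_depth :: "'a forest \<Rightarrow> nat" where
  "binary_depth [] = 0"
| "binary_depth (Node a f # g) = Suc (max (binary_depth f) (binary_depth g))"

lemma finite_binary_depth:
  assumes "finite A"
  shows "finite {f \<in> forests A. binary_depth f \<le> d}"
proof (induction d)
  case 0
  have "f = []" if "binary_depth f \<le> 0" for f :: "'a forest"
    using that by (cases f rule: binary_depth.cases) auto
  then show ?case by (auto intro: finite_subset[of _ "{[]}"])
next
  case (Suc d)
  let ?S = "{f \<in> forests A. binary_depth f \<le> d}"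
  have "f \<in> insert [] ((\<lambda>(a, f, g). Node a f # g) ` (A \<times> ?S \<times> ?S))"
    if "f \<in> forests A" "binary_depth f \<le> Suc d" for f
    using that by (cases f rule: binary_depth.cases) (auto simp: image_iff)
  then have "{f \<in> forests A. binary_depth f \<le> Suc d} \<subseteq>
      insert [] ((\<lambda>(a, f, g). Node a f # g) ` (A \<times> ?S \<times> ?S))" by blast
  then show ?case using Suc assms by (auto intro: finite_subset)
qed

section \<open>Reduced forests and the criterion for recognized languages\<close>

locale recognizer =
  fixes A :: "'a set" and H :: "'h set" and \<alpha> :: "'a forest \<Rightarrow> 'h"
    and zero :: 'h and add :: "'h \<Rightarrow> 'h \<Rightarrow> 'h" and node :: "'a \<Rightarrow> 'h \<Rightarrow> 'h"
  assumes finite_A: "finite A" and finite_H: "finite H"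
    and \<alpha>_in: "f \<in> forests A \<Longrightarrow> \<alpha> f \<in> H"
    and \<alpha>_Nil: "\<alpha> [] = zero"
    and \<alpha>_append: "f \<in> forests A \<Longrightarrow> g \<in> forests A \<Longrightarrow> \<alpha> (f @ g) = add (\<alpha> f) (\<alpha> g)"
    and \<alpha>_Node: "a \<in> A \<Longrightarrow> f \<in> forests A \<Longrightarrow> \<alpha> [Node a f] = node a (\<alpha> f)"
begin

lemma \<alpha>_Cons:
  "a \<in> A \<Longrightarrow> f \<in> forests A \<Longrightarrow> g \<in> forests A \<Longrightarrow>
    \<alpha> (Node a f # g) = add (node a (\<alpha> f)) (\<alpha> g)"
  using \<alpha>_append[of "[Node a f]" g] \<alpha>_Node by simp

text \<open>These are the minimal elements of the fibres of \<open>\<alpha>\<close> under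
  \<open>embeds\<close>.\<close>

definition reduced :: "'a forest \<Rightarrow> bool" where
  "reduced f \<longleftrightarrow> (\<forall>f'. embeds f' f \<longrightarrow> \<alpha> f' = \<alpha> f \<longrightarrow> f' = f)"

lemma ex_reduced: "\<exists>f'. embeds f' f \<and> \<alpha> f' = \<alpha> f \<and> reduced f'"
proof -
  let ?P = "\<lambda>f'. embeds f' f \<and> \<alpha> f' = \<alpha> f"
  obtain f' where f': "?P f'" "\<And>f''. ?P f'' \<Longrightarrow> forest_size f' \<le> forest_size f''"
    using ex_has_least_nat[of ?P f forest_size] embeds_refl by blast
  have "reduced f'"
    unfolding reduced_def
  proof (intro allI impI)
    fix f'' assume "embeds f'' f'" "\<alpha> f'' = \<alpha> f'"
    then show "f'' = f'" using f' embeds_trans embeds_size by (metis leD)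
  qed
  then show ?thesis using f'(1) by blast
qed

text \<open>Replacing the children or the siblings by an embedded forest of equal value preserves
  the value of the whole, so a proper replacement in a part would contradict minimality of the
  whole.\<close>

lemma reduced_Cons:
  assumes "reduced (Node a f # g)" "Node a f # g \<in> forests A"
  shows "reduced f" "reduced g"
proof -
  have in_A: "a \<in> A" "f \<in> forests A" "g \<in> forests A" using assms(2) by auto
  show "reduced f"
    unfolding reduced_def
  proof (intro allI impI)
    fix f' assume f': "embeds f' f" "\<alpha> f' = \<alpha> f"
    then have "\<alpha> (Node a f' # g) = \<alpha> (Node a f # g)"
      using in_A embeds_forests[OF f'(1)] by (simp add: \<alpha>_Cons)
    then have "Node a f' # g = Node a f # g"
      by (rule assms(1)[unfolded reduced_def, rule_format, OF embeds_keep[OF f'(1) embeds_refl]])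
    then show "f' = f" by simp
  qed
  show "reduced g"
    unfolding reduced_def
  proof (intro allI impI)
    fix g' assume g': "embeds g' g" "\<alpha> g' = \<alpha> g"
    then have "\<alpha> (Node a f # g') = \<alpha> (Node a f # g)"
      using in_A embeds_forests[OF g'(1)] by (simp add: \<alpha>_Cons)
    then have "Node a f # g' = Node a f # g"
      by (rule assms(1)[unfolded reduced_def, rule_format, OF embeds_keep[OF embeds_refl g'(1)]])
    then show "g' = g" by simp
  qed
qed

text \<open>Pumping: along a path of the binary tree the values of a reduced forest are distinct.\<close>

lemma reduced_binary_depth:
  "reduced f \<Longrightarrow> f \<in> forests A \<Longrightarrow> finite U \<Longrightarrow> (\<And>f'. embeds f' f \<Longrightarrow> \<alpha> f' \<in> U) \<Longrightarrow>
    binary_depth f \<le> card U"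
proof (induction f arbitrary: U rule: forest_induct)
  case (Cons a f g)
  let ?h = "Node a f # g"
  let ?U = "U - {\<alpha> ?h}"
  have parts: "reduced f" "reduced g" "f \<in> forests A" "g \<in> forests A" "finite ?U"
    using reduced_Cons[OF Cons.prems(1,2)] Cons.prems(2,3) by auto
  \<comment> \<open>Forests embedded in \<open>f\<close> or \<open>g\<close> embed in
    \<open>?h\<close> and are smaller, so their values differ from \<open>\<alpha> ?h\<close>. The
    set of available values thus loses an element at each step down the binary tree.\<close>
  have distinct: "\<alpha> h' \<in> ?U" if "embeds h' ?h" "h' \<noteq> ?h" for h'
    using that Cons.prems(1,4) unfolding reduced_def by blast
  have "\<alpha> f' \<in> ?U" if "embeds f' f" for f'
  proof (rule distinct)
    show "embeds f' ?h" using embeds_drop[OF that embeds_empty[of g]] by simp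
    have "forest_size f' \<le> forest_size f" using embeds_size[OF that] by auto
    then show "f' \<noteq> ?h" by auto
  qed
  then have "binary_depth f \<le> card ?U"
    by (rule Cons.IH(1)[OF parts(1) parts(3) parts(5)])
  moreover have "\<alpha> g' \<in> ?U" if "embeds g' g" for g'
  proof (rule distinct)
    show "embeds g' ?h" using embeds_drop[OF embeds_empty[of f] that] by simp
    have "forest_size g' \<le> forest_size g" using embeds_size[OF that] by auto
    then show "g' \<noteq> ?h" by auto
  qed
  then have "binary_depth g \<le> card ?U"
    by (rule Cons.IH(2)[OF parts(2) parts(4) parts(5)])
  moreover have "card U = Suc (card ?U)"
    using Cons.prems(3,4) embeds_refl by (metis card_Suc_Diff1)
  ultimately show ?case by simp
qed simp

lemma embeds_closed_imp_sigma1_definable: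
  assumes closed: "embeds_closed A {f \<in> forests A. \<alpha> f \<in> X}"
  shows "sigma1_definable A {f \<in> forests A. \<alpha> f \<in> X}" (is "sigma1_definable A ?L")
proof (cases "[] \<in> ?L")
  case True
  \<comment> \<open>The empty forest embeds in every forest, so here closure makes \<open>?L\<close>
    the set of all forests over \<open>A\<close>.\<close>
  then have "?L = {f \<in> forests A. satisfies f (Exists 0 Tru)}"
    using closed embeds_empty unfolding embeds_closed_def by fastforce
  moreover have "sigma1_sentence A (Exists 0 Tru)" by simp
  ultimately show ?thesis unfolding sigma1_definable_def by blast
next
  case False
  \<comment> \<open>By \<open>reduced_binary_depth\<close>, taken with all of \<open>H\<close>, this
    set contains every reduced member of \<open>?L\<close>, and it is finite.\<close>
  define B where "B = {b \<in> ?L. binary_depth b \<le> card H}"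
  have "\<exists>b \<in> B. embeds b f" if "f \<in> ?L" for f
  proof -
    obtain b where b: "embeds b f" "\<alpha> b = \<alpha> f" "reduced b" using ex_reduced by blast
    then have "b \<in> ?L" using that embeds_forests by auto
    moreover from this have "binary_depth b \<le> card H"
      using reduced_binary_depth[OF b(3) _ finite_H] \<alpha>_in embeds_forests by blast
    ultimately show ?thesis using b(1) B_def by blast
  qed
  then have "?L = {g \<in> forests A. \<exists>b \<in> B. embeds b g}"
    using closed unfolding B_def embeds_closed_def by blast
  moreover have "sigma1_definable A {g \<in> forests A. \<exists>b \<in> B. embeds b g}"
  proof (rule sigma1_definable_finite_basis)
    show "finite B"
      by (rule finite_subset[OF _ finite_binary_depth[OF finite_A, of "card H"]])
        (auto simp: B_def)
  qed (use False in \<open>auto simp: B_def\<close>)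
  ultimately show ?thesis by simp
qed

text \<open>The least \<open>Q\<close> that satisfies the first two conditions is the set of all pairs
  \<open>(\<alpha> f, \<alpha> g)\<close> with \<open>embeds f g\<close>.\<close>

lemma sigma1_definable_iff:
  "sigma1_definable A {f \<in> forests A. \<alpha> f \<in> X} \<longleftrightarrow>
     (\<exists>Q \<subseteq> H \<times> H. (zero, zero) \<in> Q \<and>
        (\<forall>(x, x') \<in> Q. \<forall>(y, y') \<in> Q. \<forall>a \<in> A. (add (node a x) y, add (node a x') y') \<in> Q \<and>
           (add x y, add (node a x') y') \<in> Q) \<and>
        (\<forall>(x, x') \<in> Q. x \<in> X \<longrightarrow> x' \<in> X))"
    (is "_ \<longleftrightarrow> (\<exists>Q \<subseteq> H \<times> H. ?base Q \<and> ?closed Q \<and> ?separating Q)")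
proof -
  let ?L = "{f \<in> forests A. \<alpha> f \<in> X}"
  have "sigma1_definable A ?L \<longleftrightarrow> embeds_closed A ?L"
    by (rule iffI[OF sigma1_definable_imp_embeds_closed embeds_closed_imp_sigma1_definable])
  also have "\<dots> \<longleftrightarrow> (\<exists>Q \<subseteq> H \<times> H. ?base Q \<and> ?closed Q \<and> ?separating Q)"
  proof
    assume closed: "embeds_closed A ?L"
    define Q where "Q = {(\<alpha> f, \<alpha> g) | f g. embeds f g \<and> f \<in> forests A \<and> g \<in> forests A}"
    have "Q \<subseteq> H \<times> H" by (auto simp: Q_def \<alpha>_in)
    moreover have "?base Q"
      unfolding Q_def \<alpha>_Nil[symmetric] using embeds_Nil by fastforce
    moreover have "?closed Q"
    proof -
      have step: "(add (node a (\<alpha> f1)) (\<alpha> f2), add (node a (\<alpha> g1)) (\<alpha> g2)) \<in> Q \<and>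
          (add (\<alpha> f1) (\<alpha> f2), add (node a (\<alpha> g1)) (\<alpha> g2)) \<in> Q"
        if "embeds f1 g1" "embeds f2 g2" "a \<in> A" "f1 \<in> forests A" "g1 \<in> forests A"
          "f2 \<in> forests A" "g2 \<in> forests A" for a f1 f2 g1 g2
      proof -
        have "(\<alpha> (Node a f1 # f2), \<alpha> (Node a g1 # g2)) \<in> Q" "(\<alpha> (f1 @ f2), \<alpha> (Node a g1 # g2)) \<in> Q"
          unfolding Q_def using that embeds_keep[OF that(1,2)] embeds_drop[OF that(1,2)]
          by (simp; metis forests_Cons forests_append)+
        then show ?thesis using that by (simp add: \<alpha>_Cons \<alpha>_append)
      qed
      have preimage: "\<exists>f g. x = \<alpha> f \<and> x' = \<alpha> g \<and> embeds f g \<and> f \<in> forests A \<and> g \<in> forests A"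
        if "(x, x') \<in> Q" for x x' using that by (auto simp: Q_def)
      have "(add (node a x) y, add (node a x') y') \<in> Q \<and> (add x y, add (node a x') y') \<in> Q"
        if "(x, x') \<in> Q" "(y, y') \<in> Q" "a \<in> A" for x x' y y' a
        using preimage[OF that(1)] preimage[OF that(2)] that(3) by (elim exE conjE) (simp add: step)
      then show ?thesis by (simp add: split_beta)
    qed
    moreover have "?separating Q" using closed by (auto simp: Q_def embeds_closed_def)
    ultimately show "\<exists>Q \<subseteq> H \<times> H. ?base Q \<and> ?closed Q \<and> ?separating Q" by blast
  next
    assume "\<exists>Q \<subseteq> H \<times> H. ?base Q \<and> ?closed Q \<and> ?separating Q"
    then obtain Q where Q: "?base Q" "?closed Q" "?separating Q" by blast
    have step: "(add (node a x) y, add (node a x') y') \<in> Q" "(add x y, add (node a x') y') \<in> Q"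
      if "(x, x') \<in> Q" "(y, y') \<in> Q" "a \<in> A" for x x' y y' a
      using bspec[OF bspec[OF Q(2) that(1), simplified] that(2)] that(3) by auto
    \<comment> \<open>Not only the least but every relation with the first two properties contains
      all value pairs of embeddings; the third property then gives closure.\<close>
    have in_Q: "embeds f g \<Longrightarrow> g \<in> forests A \<Longrightarrow> (\<alpha> f, \<alpha> g) \<in> Q" for f g
    proof (induction rule: embeds.induct)
      case embeds_Nil
      show ?case using Q(1) by (simp add: \<alpha>_Nil)
    next
      case (embeds_keep f1 g1 f2 g2 a)
      note pieces = embeds_forests[OF embeds_keep.hyps(1)] embeds_forests[OF embeds_keep.hyps(2)]
      show ?case
        using step[OF embeds_keep.IH] embeds_keep.prems pieces by (simp add: \<alpha>_Cons)
    next
      case (embeds_drop f1 g1 f2 g2 a)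
      note pieces = embeds_forests[OF embeds_drop.hyps(1)] embeds_forests[OF embeds_drop.hyps(2)]
      show ?case
        using step[OF embeds_drop.IH] embeds_drop.prems pieces by (simp add: \<alpha>_Cons \<alpha>_append)
    qed
    show "embeds_closed A ?L"
      unfolding embeds_closed_def using bspec[OF Q(3) in_Q] by auto
  qed
  finally show ?thesis .
qed

end

section \<open>The decision procedure\<close>

lemma letter_context_in_contexts: "a \<in> A \<Longrightarrow> letter_context a \<in> contexts A"
  by (auto simp: contexts_def letter_context_def nodes_Cons label_at_def leaf_at_def)

lemma fill_letter_context: "fill id f (letter_context a) = [Node a f]"
  by (simp add: fill_def letter_context_def)

text \<open>A tree \<open>[Node a f]\<close> is \<open>letter_context a\<close> applied to
  \<open>f\<close>. So the vertical monoid enters only through the actions of the letters, and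
  \<open>\<alpha>\<close> is computed by operations on the horizontal carrier.\<close>

lemma recognizer_morphism:
  assumes "forest_algebra F" and H: "finite (carrier (hor F))"
    and morphism: "forest_alg_morphism (free_forest_algebra A) F \<alpha> \<beta>" and "finite A"
  shows "recognizer A (carrier (hor F)) \<alpha> \<one>\<^bsub>hor F\<^esub> (mult (hor F))
    (\<lambda>a. act F (\<beta> (letter_context a)))"
proof
  show "\<alpha> [Node a f] = act F (\<beta> (letter_context a)) (\<alpha> f)" if "a \<in> A" "f \<in> forests A" for a f
  proof -
    have "\<alpha> (act (free_forest_algebra A) (letter_context a) f) = act F (\<beta> (letter_context a)) (\<alpha> f)"
      using morphism that letter_context_in_contexts[OF that(1)]
      unfolding forest_alg_morphism_def by (simp add: free_forest_algebra_def)
    then show ?thesis by (simp add: free_forest_algebra_def fill_letter_context)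
  qed
qed (use assms in \<open>auto simp: forest_alg_morphism_def monoid_morphism_def hom_def
  free_forest_algebra_def\<close>)

section \<open>Numerical codes of relations and the test\<close>

lemma set_encode_less: "S \<subseteq> {..<n} \<Longrightarrow> set_encode S < 2 ^ n"
proof -
  assume "S \<subseteq> {..<n}"
  then have "set_encode S \<le> (\<Sum>i<n. 2 ^ i)"
    unfolding set_encode_def by (intro sum_mono2) auto
  also have "\<dots> < (2 :: nat) ^ n" by (induction n) auto
  finally show ?thesis .
qed

lemma pair_code_inject:
  fixes m x x' y y' :: nat
  assumes "x' < m" "y' < m"
  shows "x * m + x' = y * m + y' \<longleftrightarrow> x = y \<and> x' = y'"
proof
  assume eq: "x * m + x' = y * m + y'"
  have "(x * m + x') div m = x" "(y * m + y') div m = y" "(x * m + x') mod m = x'"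
    "(y * m + y') mod m = y'"
    using assms by (auto simp: div_mult_self3)
  then show "x = y \<and> x' = y'" using eq by simp
qed simp

lemma pair_code_less:
  fixes m x x' :: nat
  assumes "x < m" "x' < m"
  shows "x * m + x' < m * m"
proof -
  have "x * m + x' < Suc x * m" using assms by simp
  also have "\<dots> \<le> m * m" using assms by (intro mult_le_mono1) simp
  finally show ?thesis .
qed

text \<open>Pairs become numbers below \<open>m * m\<close>, and sets of these become binary
  expansions. The conditions \<open>x < m\<close> and \<open>x' < m\<close> keep distinct pairs from
  sharing a number. An arbitrary \<open>P\<close> lets a whole formula be transferred at
  once.\<close>

lemma ex_relation_iff_ex_code:
  fixes m :: nat
  shows "(\<exists>Q \<subseteq> {..<m} \<times> {..<m}. P (\<lambda>x x'. (x, x') \<in> Q)) \<longleftrightarrow>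
    (\<exists>q<2 ^ (m * m). P (\<lambda>x x'. x < m \<and> x' < m \<and> x * m + x' \<in> set_decode q))"
proof (intro iffI; elim exE conjE)
  fix Q assume Q: "Q \<subseteq> {..<m} \<times> {..<m}" "P (\<lambda>x x'. (x, x') \<in> Q)"
  let ?S = "(\<lambda>(x, x'). x * m + x') ` Q"
  have "finite Q" using Q(1) by (rule finite_subset) simp
  then have decode: "set_decode (set_encode ?S) = ?S" by simp
  have "?S \<subseteq> {..<m * m}" using Q(1) pair_code_less by auto
  then have "set_encode ?S < 2 ^ (m * m)" by (rule set_encode_less)
  moreover have "(x < m \<and> x' < m \<and> x * m + x' \<in> ?S) \<longleftrightarrow> (x, x') \<in> Q" for x x'
    using Q(1) pair_code_inject by (auto simp: image_iff intro!: bexI[of _ "(x, x')"])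
  ultimately show "\<exists>q<2 ^ (m * m). P (\<lambda>x x'. x < m \<and> x' < m \<and> x * m + x' \<in> set_decode q)"
    using Q(2) decode by (intro exI[of _ "set_encode ?S"]) simp
next
  fix q assume "P (\<lambda>x x'. x < m \<and> x' < m \<and> x * m + x' \<in> set_decode q)"
  then show "\<exists>Q \<subseteq> {..<m} \<times> {..<m}. P (\<lambda>x x'. (x, x') \<in> Q)"
    by (intro exI[of _ "{(x, x'). x < m \<and> x' < m \<and> x * m + x' \<in> set_decode q}"]) auto
qed

text \<open>The constants here and below are positions in the list of \<open>encodes\<close>: 0
  alphabet size, 1 horizontal size, 3 neutral element, 4 addition, 7 action, 10 letter images, 11
  accepting set.\<close>

abbreviation code_order :: "nat \<Rightarrow> nat" where
  "code_order c \<equiv> code_nth c 1"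

abbreviation code_add :: "nat \<Rightarrow> nat \<Rightarrow> nat \<Rightarrow> nat" where
  "code_add c x y \<equiv> code_nth (code_nth (code_nth c 4) x) y"

abbreviation code_node :: "nat \<Rightarrow> nat \<Rightarrow> nat \<Rightarrow> nat" where
  "code_node c a x \<equiv> code_nth (code_nth (code_nth c 7) (code_nth (code_nth c 10) a)) x"

text \<open>This is the criterion of \<open>sigma1_definable_iff\<close> with \<open>Q\<close> coded
  by \<open>q\<close>; bounding all variables by numbers computed from \<open>c\<close> brings it
  within \<open>recursive_intros\<close>.\<close>

definition sigma1_test :: "nat \<Rightarrow> bool" where
  "sigma1_test c \<longleftrightarrow> (\<exists>q<2 ^ (code_order c * code_order c).
     code_nth c 3 * code_order c + code_nth c 3 \<in> set_decode q \<and>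
     (\<forall>x<code_order c. \<forall>x'<code_order c. x * code_order c + x' \<in> set_decode q \<longrightarrow>
       (\<forall>y<code_order c. \<forall>y'<code_order c. y * code_order c + y' \<in> set_decode q \<longrightarrow>
         (\<forall>a<code_nth c 0.
           code_add c (code_node c a x) y * code_order c + code_add c (code_node c a x') y'
             \<in> set_decode q \<and>
           code_add c x y * code_order c + code_add c (code_node c a x') y' \<in> set_decode q))) \<and>
     (\<forall>x<code_order c. \<forall>x'<code_order c. x * code_order c + x' \<in> set_decode q \<longrightarrow>
       code_mem x (code_nth c 11) \<longrightarrow> code_mem x' (code_nth c 11)))"

lemma decidable_sigma1_test: "decidable 1 (\<lambda>xs. sigma1_test (hd xs))"
  unfolding sigma1_test_def
  by (intro recursive_intros recursive_code_nth decidable_code_mem decidable_mem_set_decode; simp)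

lemma sigma1_test_iff:
  assumes "encodes n c L"
  shows "sigma1_test c \<longleftrightarrow> sigma1_definable {..<n} L"
proof -
  obtain F :: "(nat, nat) forest_alg" and m k \<alpha> \<beta> X where
    F: "forest_algebra F" "carrier (hor F) = {..<m}" "carrier (ver F) = {..<k}"
      "forest_alg_morphism (free_forest_algebra {..<n}) F \<alpha> \<beta>" and
    X: "X \<subseteq> carrier (hor F)" "L = {f \<in> forests {..<n}. \<alpha> f \<in> X}" and
    c: "c = list_encode
      [n, m, k, \<one>\<^bsub>hor F\<^esub>, encode_table (mult (hor F)) m m,
       \<one>\<^bsub>ver F\<^esub>, encode_table (mult (ver F)) k k, encode_table (act F) k m,
       list_encode (map (ins_left F) [0..<m]), list_encode (map (ins_right F) [0..<m]),
       list_encode (map (\<lambda>a. \<beta> (letter_context a)) [0..<n]),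
       list_encode (sorted_list_of_set X)]"
    using assms unfolding encodes_def by blast
  define node where "node a = act F (\<beta> (letter_context a))" for a
  interpret recognizer "{..<n}" "{..<m}" \<alpha> "\<one>\<^bsub>hor F\<^esub>" "mult (hor F)" node
    using recognizer_morphism[OF F(1) _ F(4)] F(2) by (simp add: node_def[abs_def])
  have one: "\<one>\<^bsub>hor F\<^esub> < m"
    using monoid.one_closed[OF forest_algebra.hor_monoid[OF F(1)]] F(2) by simp
  have letter: "\<beta> (letter_context a) < k" if "a < n" for a
    using F(3,4) letter_context_in_contexts[of a "{..<n}"] that
    by (auto simp: forest_alg_morphism_def monoid_morphism_def hom_def free_forest_algebra_def Pi_iff)
  have add_less: "x \<otimes>\<^bsub>hor F\<^esub> y < m" if "x < m" "y < m" for x y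
    using monoid.m_closed[OF forest_algebra.hor_monoid[OF F(1)], of x y] F(2) that by simp
  have node_less: "node a x < m" if "a < n" "x < m" for a x
    using forest_algebra.act_closed[OF F(1), of "\<beta> (letter_context a)" x] F(2,3) letter that
    by (simp add: node_def)
  have code: "code_nth c 0 = n" "code_nth c 1 = m" "code_nth c 3 = \<one>\<^bsub>hor F\<^esub>"
      "code_nth c 4 = encode_table (mult (hor F)) m m" "code_nth c 7 = encode_table (act F) k m"
      "code_nth c 10 = list_encode (map (\<lambda>a. \<beta> (letter_context a)) [0..<n])"
      "code_nth c 11 = list_encode (sorted_list_of_set X)"
    unfolding c by (subst code_nth_list_encode; simp)+
  have "finite X" using X(1) F(2) by (auto intro: finite_subset)
  then have mem: "code_mem x (code_nth c 11) \<longleftrightarrow> x \<in> X" for x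
    by (simp add: code code_mem_list_encode)
  have add: "code_add c x y = x \<otimes>\<^bsub>hor F\<^esub> y" if "x < m" "y < m" for x y
    using that by (simp add: code code_nth_encode_table)
  have node: "code_node c a x = node a x" if "a < n" "x < m" for a x
    using that letter by (simp add: code code_nth_encode_table code_nth_list_encode node_def)
  let ?P = "\<lambda>R. R \<one>\<^bsub>hor F\<^esub> \<one>\<^bsub>hor F\<^esub> \<and>
      (\<forall>x x'. R x x' \<longrightarrow> (\<forall>y y'. R y y' \<longrightarrow> (\<forall>a<n.
        R (node a x \<otimes>\<^bsub>hor F\<^esub> y) (node a x' \<otimes>\<^bsub>hor F\<^esub> y') \<and>
        R (x \<otimes>\<^bsub>hor F\<^esub> y) (node a x' \<otimes>\<^bsub>hor F\<^esub> y')))) \<and>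
      (\<forall>x x'. R x x' \<longrightarrow> x \<in> X \<longrightarrow> x' \<in> X)"
  have "sigma1_definable {..<n} L \<longleftrightarrow> (\<exists>Q \<subseteq> {..<m} \<times> {..<m}. ?P (\<lambda>x x'. (x, x') \<in> Q))"
    unfolding X(2) sigma1_definable_iff by (simp add: split_beta' Ball_def)
  also have "\<dots> \<longleftrightarrow> (\<exists>q<2 ^ (m * m). ?P (\<lambda>x x'. x < m \<and> x' < m \<and> x * m + x' \<in> set_decode q))"
    by (rule ex_relation_iff_ex_code)
  \<comment> \<open>The test imposes the bound \<open>m\<close> on the quantified variables only;
    the composite values stay below \<open>m\<close> because the operations are closed on the
    carrier.\<close>
  also have "\<dots> \<longleftrightarrow> sigma1_test c"
    unfolding sigma1_test_def mem code(1-3)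
    by (intro ex_cong conj_cong refl)
      (auto simp: one add node add_less node_less)
  finally show ?thesis ..
qed

theorem theorem32:
  shows "\<exists>p. \<forall>n c L. encodes n c L \<longrightarrow>
           computes p [c] (if sigma1_definable {..<n} L then 1 else 0)"
proof -
  obtain p where p: "\<And>xs. length xs = 1 \<Longrightarrow> computes p xs (if sigma1_test (hd xs) then 1 else 0)"
    using decidable_sigma1_test unfolding decidable_def recursive_def by blast
  have "computes p [c] (if sigma1_definable {..<n} L then 1 else 0)" if "encodes n c L" for n c L
    using p[of "[c]"] sigma1_test_iff[OF that] by simp
  then show ?thesis by blast
qed

end
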